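(* Let $\mathcal{D}$ be a dyadic lattice in $\mathbb{R}^d$ and let $E\subset\mathbb{R}^d$ be a nonempty set with $|\overline{E}|=0$. Then the Aikawa--Assouad codimension $\mathrm{codim}_A E$ equals the supremum of those $\alpha\ge0$ for which there is a constant $\zeta>0$ such that for each cube $R\in\mathcal{D}$ $$\sum_{Q\in\mathcal{D}_E(R)}|Q|^{1-\alpha/d}\leq\zeta\,|R|^{1-\alpha/d},$$ and it also equals the supremum of those $\alpha\ge0$ for which there is a constant $\xi>0$ such that for each cube $R\in\mathcal{D}$ $$\sum_{Q\in\mathcal{D}_E(R)}\mu_{\alpha,E}(Q)\leq\xi\,\mu_{\alpha,E}(R).$$
   Context: $|A|$ denotes $d$-dimensional Lebesgue measure of $A$, and $\overline{E}$ is the closure of $E$. Distances are taken in the $l_\infty$-metric: $\mathrm{dist}(F,E)=\inf_{x\in F,\,y\in E}\max_{1\le i\le d}|x_i-y_i|$, and $\mathrm{dist}(x,E)=\mathrm{dist}(\{x\},E)$. A cube is a half-open set $Q=[a_1,b_1)\times\dots\times[a_d,b_d)$ with equal side lengths $\ell(Q)=b_1-a_1=\dots=b_d-a_d>0$. For a cube $R$, $\mathcal{D}(R)=\bigcup_{j\ge0}\mathcal{D}_j(R)$, where $\mathcal{D}_j(R)$ is the collection of the $2^{jd}$ pairwise disjoint half-open cubes of side length $2^{-j}\ell(R)$ whose union is $R$. A dyadic lattice $\mathcal{D}$ is a collection of cubes such that: (DL1) if $Q\in\mathcal{D}$ then $\mathcal{D}(Q)\subset\mathcal{D}$; (DL2)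 any two cubes $Q',Q''\in\mathcal{D}$ have a common ancestor, i.e. there is $Q\in\mathcal{D}$ with $Q',Q''\in\mathcal{D}(Q)$; (DL3) for every compact $K\subset\mathbb{R}^d$ there is a cube $Q\in\mathcal{D}$ containing $K$. For $Q\in\mathcal{D}$, $\pi Q$ is the unique cube in $\mathcal{D}$ with $Q\in\mathcal{D}_1(\pi Q)$. For $R\in\mathcal{D}$, $\mathcal{D}_E(R)=\{Q\in\mathcal{D}(R): Q\cap E\ne\varnothing\}$, $\mathcal{D}_E=\bigcup_{R\in\mathcal{D}}\mathcal{D}_E(R)$, and $\mathcal{F}_E(R)=\{Q'\in\mathcal{D}(R): Q'\cap E=\varnothing,\ Q'\ne R,\ \pi Q'\cap E\ne\varnothing\}$. $\mu_{\alpha,E}(R)=\int_R \mathrm{dist}(x,E)^{-\alpha}\,dx$. The Aikawa--Assouad codimension $\mathrm{codim}_A E$ is the supremum of those $\alpha\ge0$ for which there is a constant $C=C(E,\alpha)>0$ such that for each $R\in\mathcal{D}_E$ one has $\sum_{Q'\in\mathcal{F}_E(R)}|Q'|^{1-\alpha/d}\le C|R|^{1-\alpha/d}$; equivalently, the supremum of those $\alpha\ge0$ for which there is $C=C(E,\alpha)>0$ such that for each $R\in\mathcal{D}_E$ one has $\mu_{\alpha,E}(R)\le C|R|^{1-\alpha/d}$. The supremum of the empty set of numbers $\alpha\ge 0$ is understood as $0$.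
   Formalization: In the last condition, μ_{α,E}(R) is also required to be finite for each cube R in the lattice; if infinite values were allowed, every α ≥ d would satisfy it (e.g. E={0}) and the supremum would be infinite, while codim_A {0} = d. *)

theory Defs
  imports "HOL-Analysis.Analysis"
begin

definition half_open_cube :: "real ^ 'd::finite \<Rightarrow> real \<Rightarrow> (real ^ 'd) set" where
  "half_open_cube a l = {x. \<forall>i. a $ i \<le> x $ i \<and> x $ i < a $ i + l}"

definition is_cube :: "(real ^ 'd::finite) set \<Rightarrow> bool" where
  "is_cube Q \<longleftrightarrow> (\<exists>a l. 0 < l \<and> Q = half_open_cube a l)"

(* The corner a and the side length l are determined by R, so this is the usual
   grid of 2 ^ (j * d) subcubes of R; it is empty if R is not a cube. *)
definition dyadic_generation :: "nat \<Rightarrow> (real ^ 'd::finite) set \<Rightarrow> (real ^ 'd) set set" where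
  "dyadic_generation j R =
     {half_open_cube (\<chi> i. a $ i + real (k $ i) * (l / 2 ^ j)) (l / 2 ^ j) | a l (k :: nat ^ 'd).
        0 < l \<and> R = half_open_cube a l \<and> (\<forall>i. k $ i < 2 ^ j)}"

definition dyadic_cubes :: "(real ^ 'd::finite) set \<Rightarrow> (real ^ 'd) set set" where
  "dyadic_cubes R = (\<Union>j. dyadic_generation j R)"

definition dyadic_lattice :: "(real ^ 'd::finite) set set \<Rightarrow> bool" where
  "dyadic_lattice D \<longleftrightarrow>
     (\<forall>Q\<in>D. is_cube Q) \<and>
     (\<forall>Q\<in>D. dyadic_cubes Q \<subseteq> D) \<and>
     (\<forall>Q'\<in>D. \<forall>Q''\<in>D. \<exists>Q\<in>D. Q' \<in> dyadic_cubes Q \<and> Q'' \<in> dyadic_cubes Q) \<and>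
     (\<forall>K. compact K \<longrightarrow> (\<exists>Q\<in>D. K \<subseteq> Q))"

definition parent :: "(real ^ 'd::finite) set set \<Rightarrow> (real ^ 'd) set \<Rightarrow> (real ^ 'd) set" where
  "parent D Q = (THE P. P \<in> D \<and> Q \<in> dyadic_generation 1 P)"

definition meeting_cubes :: "(real ^ 'd::finite) set \<Rightarrow> (real ^ 'd) set \<Rightarrow> (real ^ 'd) set set" where
  "meeting_cubes E R = {Q \<in> dyadic_cubes R. Q \<inter> E \<noteq> {}}"

definition maximal_free_cubes ::
  "(real ^ 'd::finite) set set \<Rightarrow> (real ^ 'd) set \<Rightarrow> (real ^ 'd) set \<Rightarrow> (real ^ 'd) set set" where
  "maximal_free_cubes D E R =
     {Q' \<in> dyadic_cubes R. Q' \<inter> E = {} \<and> Q' \<noteq> R \<and> parent D Q' \<inter> E \<noteq> {}}"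

(* Distance in the maximum norm; meaningful for nonempty E only. *)
definition max_dist :: "real ^ 'd::finite \<Rightarrow> (real ^ 'd) set \<Rightarrow> real" where
  "max_dist x E = (INF y\<in>E. infnorm (x - y))"

(* max_dist x E to the power -\<alpha>, with 0 to the power -\<alpha> equal to \<infinity> for \<alpha> > 0 and to 1 for
   \<alpha> = 0; the case distinction is needed because 0 powr 0 = 0. *)
definition dist_weight :: "real \<Rightarrow> (real ^ 'd::finite) set \<Rightarrow> real ^ 'd \<Rightarrow> ennreal" where
  "dist_weight \<alpha> E x = (if \<alpha> = 0 then 1 else 1 / ennreal (max_dist x E powr \<alpha>))"

definition weight_measure :: "real \<Rightarrow> (real ^ 'd::finite) set \<Rightarrow> (real ^ 'd) set \<Rightarrow> ennreal" where
  "weight_measure \<alpha> E R = (\<integral>\<^sup>+x\<in>R. dist_weight \<alpha> E x \<partial>lebesgue)"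

definition scaled_volume :: "real \<Rightarrow> (real ^ 'd::finite) set \<Rightarrow> ennreal" where
  "scaled_volume \<alpha> Q = ennreal (measure lebesgue Q powr (1 - \<alpha> / real CARD('d)))"

(* The suprema are taken in ennreal, where the supremum of the empty set is 0. *)
definition codim_A :: "(real ^ 'd::finite) set set \<Rightarrow> (real ^ 'd) set \<Rightarrow> ennreal" where
  "codim_A D E =
     (SUP \<alpha> \<in> {\<alpha>::real. 0 \<le> \<alpha> \<and> (\<exists>C::real. 0 < C \<and>
          (\<forall>R \<in> (\<Union>S\<in>D. meeting_cubes E S).
             (\<Sum>\<^sub>\<infinity>Q' \<in> maximal_free_cubes D E R. scaled_volume \<alpha> Q')
               \<le> ennreal C * scaled_volume \<alpha> R))}. ennreal \<alpha>)"

end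

theory Submission imports Defs begin

text \<open>Every sum over dyadic subcubes of \<open>R\<close> is turned into an integral over \<open>R\<close> of a sum along the
  nested cubes containing a point \<open>x\<close>. Almost every \<open>x\<close> leaves \<open>closure E\<close>, so it lies in finitely
  many cubes meeting \<open>E\<close>, and for \<open>\<alpha> > 0\<close> the corresponding geometric sum of \<open>side powr - \<alpha>\<close> is
  comparable to its last term, which belongs to a maximal free cube. This shows that the bounds on
  the meeting cubes and on the maximal free cubes are equivalent. Both are equivalent to
  \<open>\<mu>(R) \<le> C |R| powr (1 - \<alpha> / d)\<close>: a point at distance about \<open>s\<close> from \<open>E\<close> lies in a neighbour of
  a cube of side \<open>s\<close> meeting \<open>E\<close>, so \<open>\<mu>(R)\<close> is controlled by the meeting cubes in the triple of
  \<open>R\<close>. It remains to derive this weight bound from the bound on the weights of the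
  meeting cubes. If it fails badly on \<open>R\<close>, then a cube of half the size inside the triple of \<open>R\<close>
  has much larger weight; iterating gives cubes in a bounded region whose weights tend to infinity,
  contradicting the local finiteness of the weight. So all the conditions agree for each \<open>\<alpha> > 0\<close>.\<close>

section \<open>Dyadic grids\<close>

text \<open>The bound on the weights of the meeting cubes compares weights with weights only, so a
  comparison with volume has to be produced from it. The source is that a point in a deep cube
  meeting \<open>E\<close> is counted once for each of its ancestors, so such points carry a small
  share of the weight. The obstacle is that the distance sees \<open>E\<close> across the faces of
  \<open>R\<close>: the estimate closes up on the triple only, and a neighbour of \<open>R\<close>
  may be much heavier than \<open>R\<close>. Nothing contradictory happens on a single cube, which
  is why smaller and heavier cubes have to be followed. The growth factor must exceed
  \<open>2 powr \<alpha>\<close>, since halving a cube may raise its scaled volume relative to the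
  weight by up to that factor, and it must exceed 1 for the weights to diverge. The geometric sums
  need \<alpha> > 0; the value \<alpha> = 0 adds nothing to a supremum in
  \<open>ennreal\<close>.\<close>

text \<open>\<open>idx a l k x\<close> addresses the cube containing \<open>x\<close> in the grid of side \<open>l / 2 ^ k\<close> with one
  corner at \<open>a\<close>. The grid covers the whole space, so that the neighbours of \<open>half_open_cube a l\<close>
  and their subcubes are addressed as well.\<close>

definition idx :: "real ^ 'd::finite \<Rightarrow> real \<Rightarrow> nat \<Rightarrow> real ^ 'd \<Rightarrow> int ^ 'd" where
  "idx a l k x = (\<chi> i. \<lfloor>(x $ i - a $ i) * 2 ^ k / l\<rfloor>)"

definition cell :: "real ^ 'd::finite \<Rightarrow> real \<Rightarrow> nat \<Rightarrow> int ^ 'd \<Rightarrow> (real ^ 'd) set" where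
  "cell a l k m = {x. idx a l k x = m}"

text \<open>A predicate of the point rather than of the cube, because sums over cubes become
  integrals over \<open>x\<close>.\<close>

definition hits :: "(real ^ 'd::finite) set \<Rightarrow> real ^ 'd \<Rightarrow> real \<Rightarrow> nat \<Rightarrow> real ^ 'd \<Rightarrow> bool" where
  "hits E a l k x \<longleftrightarrow> (\<exists>y\<in>E. idx a l k y = idx a l k x)"

definition corner :: "real ^ 'd::finite \<Rightarrow> real \<Rightarrow> nat \<Rightarrow> int ^ 'd \<Rightarrow> real ^ 'd" where
  "corner a l k m = (\<chi> i. a $ i + of_int (m $ i) * (l / 2 ^ k))"

lemma idx_nth_eq_iff:
  assumes "0 < l"
  shows "idx a l k x $ i = n \<longleftrightarrow>
    a $ i + of_int n * (l / 2 ^ k) \<le> x $ i \<and> x $ i < a $ i + (of_int n + 1) * (l / 2 ^ k)"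
proof -
  have "idx a l k x $ i = n \<longleftrightarrow> of_int n \<le> (x $ i - a $ i) * 2 ^ k / l \<and> (x $ i - a $ i) * 2 ^ k / l < of_int n + 1"
    by (simp add: idx_def floor_eq_iff)
  also have "of_int n \<le> (x $ i - a $ i) * 2 ^ k / l \<longleftrightarrow> a $ i + of_int n * (l / 2 ^ k) \<le> x $ i"
    using assms by (simp add: field_simps)
  also have "(x $ i - a $ i) * 2 ^ k / l < of_int n + 1 \<longleftrightarrow> x $ i < a $ i + (of_int n + 1) * (l / 2 ^ k)"
    using assms by (simp add: field_simps)
  finally show ?thesis .
qed

lemma cell_eq_half_open_cube:
  assumes "0 < l"
  shows "cell a l k m = half_open_cube (corner a l k m) (l / 2 ^ k)"
  unfolding cell_def half_open_cube_def vec_eq_iff corner_def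
  by (simp add: idx_nth_eq_iff[OF assms] distrib_right add.assoc add_divide_distrib)

lemma half_open_cube_eq_cell:
  assumes "0 < l"
  shows "half_open_cube a l = cell a l 0 0"
  using cell_eq_half_open_cube[OF assms, of a 0 0] by (simp add: corner_def)

lemma mem_half_open_cube_iff_idx:
  assumes "0 < l"
  shows "x \<in> half_open_cube a l \<longleftrightarrow> (\<forall>i. 0 \<le> idx a l k x $ i \<and> idx a l k x $ i < 2 ^ k)"
proof -
  have "0 \<le> idx a l k x $ i \<longleftrightarrow> a $ i \<le> x $ i" for i
    using assms zero_less_power[of "2 :: real" k]
    by (auto simp: idx_def zero_le_divide_iff zero_le_mult_iff simp del: zero_less_power)
  moreover have "idx a l k x $ i < 2 ^ k \<longleftrightarrow> x $ i < a $ i + l" for i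
  proof -
    have "idx a l k x $ i < 2 ^ k \<longleftrightarrow> (x $ i - a $ i) * 2 ^ k < l * 2 ^ k"
      using assms by (simp add: idx_def floor_less_iff divide_less_eq mult.commute)
    also have "\<dots> \<longleftrightarrow> x $ i - a $ i < l"
      by simp
    finally show ?thesis by linarith
  qed
  ultimately show ?thesis by (simp add: half_open_cube_def)
qed

text \<open>Each corner lies in its own cube, hence componentwise above the other corner; the sides
  are then compared along the diagonal. This lets a cube be treated as a pair of corner and
  side.\<close>

lemma half_open_cube_inject:
  fixes a b :: "real ^ 'd::finite"
  assumes "0 < l" "0 < m" and eq: "half_open_cube a l = half_open_cube b m"
  shows "a = b \<and> l = m"
proof -
  have "a \<in> half_open_cube b m" "b \<in> half_open_cube a l"
    using assms by (auto simp: half_open_cube_def)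
  then have ab: "a = b"
    by (auto simp: half_open_cube_def vec_eq_iff intro: antisym)
  have "l \<le> m" if "half_open_cube a l \<subseteq> half_open_cube a m" "0 < l" for l m
  proof (rule ccontr)
    assume "\<not> l \<le> m"
    \<comment> \<open>The local claim says nothing about the sign of \<open>m\<close>;
      \<open>max m 0\<close> keeps the point inside the larger cube in any case.\<close>
    then have "(\<chi> i. a $ i + max m 0) \<in> half_open_cube a l"
      using that(2) by (simp add: half_open_cube_def)
    then have "(\<chi> i. a $ i + max m 0) \<in> half_open_cube a m"
      using that by blast
    then show False by (simp add: half_open_cube_def)
  qed
  then have "l \<le> m" "m \<le> l"
    using assms(1,2) eq unfolding ab by blast+
  then show ?thesis
    using ab by simp
qed

text \<open>Choosing another grid cube as base shifts the levels by \<open>j\<close> and the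
  addresses by an integer vector, without changing the finer grid. Statements about a base cube
  thereby apply to every cube of its grid.\<close>

lemma idx_corner:
  fixes a :: "real ^ 'd::finite"
  assumes "0 < l"
  shows "idx (corner a l j m) (l / 2 ^ j) k x = idx a l (j + k) x - (\<chi> i. 2 ^ k * m $ i)"
proof -
  have "(x $ i - corner a l j m $ i) * 2 ^ k / (l / 2 ^ j) =
     (x $ i - a $ i) * 2 ^ (j + k) / l - of_int (2 ^ k * m $ i)" for i
    using assms by (simp add: corner_def field_simps power_add)
  then show ?thesis
    unfolding vec_eq_iff idx_def by (simp only: floor_diff_of_int vec_lambda_beta vector_minus_component) simp
qed

lemma cell_idx_corner:
  assumes "0 < l"
  shows "cell (corner a l j m) (l / 2 ^ j) k (idx (corner a l j m) (l / 2 ^ j) k x) = cell a l (j + k) (idx a l (j + k) x)"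
  by (simp add: cell_def idx_corner[OF assms])

lemma hits_corner:
  assumes "0 < l"
  shows "hits E (corner a l j m) (l / 2 ^ j) k x = hits E a l (j + k) x"
  by (simp add: hits_def idx_corner[OF assms])

lemma dyadic_generation_half_open_cube:
  fixes a :: "real ^ 'd::finite"
  assumes "0 < l"
  shows "dyadic_generation k (half_open_cube a l) = {cell a l k m |m. \<forall>i. 0 \<le> m $ i \<and> m $ i < 2 ^ k}"
proof -
  have 1: "dyadic_generation k (half_open_cube a l) =
      {half_open_cube (\<chi> i. a $ i + real (n $ i) * (l / 2 ^ k)) (l / 2 ^ k) |n. \<forall>i. n $ i < 2 ^ k}"
    (is "_ = ?S")
  proof (intro equalityI subsetI)
    fix Q assume "Q \<in> dyadic_generation k (half_open_cube a l)"
    then obtain b m and n :: "nat ^ 'd" where "0 < m" "half_open_cube a l = half_open_cube b m"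
      and n: "\<forall>i. n $ i < 2 ^ k" "Q = half_open_cube (\<chi> i. b $ i + real (n $ i) * (m / 2 ^ k)) (m / 2 ^ k)"
      unfolding dyadic_generation_def by blast
    then have "a = b \<and> l = m"
      using assms by (intro half_open_cube_inject)
    then show "Q \<in> ?S" using n by blast
  next
    fix Q assume "Q \<in> ?S"
    then show "Q \<in> dyadic_generation k (half_open_cube a l)"
      unfolding dyadic_generation_def using assms by blast
  qed
  show ?thesis
  proof (intro equalityI subsetI)
    fix Q assume "Q \<in> dyadic_generation k (half_open_cube a l)"
    then obtain n :: "nat ^ 'd" where n: "\<forall>i. n $ i < 2 ^ k"
      and Q: "Q = half_open_cube (\<chi> i. a $ i + real (n $ i) * (l / 2 ^ k)) (l / 2 ^ k)"
      unfolding 1 by blast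
    have "Q = cell a l k (\<chi> i. int (n $ i))"
      unfolding Q cell_eq_half_open_cube[OF assms] by (simp add: corner_def)
    moreover have "\<forall>i. 0 \<le> (\<chi> i. int (n $ i)) $ i \<and> (\<chi> i. int (n $ i)) $ i < 2 ^ k"
      using n by (simp add: of_nat_less_numeral_power_cancel_iff)
    ultimately show "Q \<in> {cell a l k m |m. \<forall>i. 0 \<le> m $ i \<and> m $ i < 2 ^ k}" by blast
  next
    fix Q assume "Q \<in> {cell a l k m |m. \<forall>i. 0 \<le> m $ i \<and> m $ i < 2 ^ k}"
    then obtain m where m: "\<forall>i. 0 \<le> m $ i \<and> m $ i < 2 ^ k" and Q: "Q = cell a l k m" by blast
    define n :: "nat ^ 'd" where "n = (\<chi> i. nat (m $ i))"
    have "\<forall>i. n $ i < 2 ^ k"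
      using m by (simp add: n_def nat_less_iff)
    moreover have "Q = half_open_cube (\<chi> i. a $ i + real (n $ i) * (l / 2 ^ k)) (l / 2 ^ k)"
      unfolding Q cell_eq_half_open_cube[OF assms] using m by (simp add: corner_def n_def)
    ultimately show "Q \<in> dyadic_generation k (half_open_cube a l)"
      unfolding 1 by blast
  qed
qed

lemma idx_corner_self:
  assumes "0 < l"
  shows "idx a l k (corner a l k m) = m"
  using assms by (simp add: idx_def corner_def vec_eq_iff)

lemma dyadic_generation_eq_image:
  assumes "0 < l"
  shows "dyadic_generation k (half_open_cube a l) = (\<lambda>x. cell a l k (idx a l k x)) ` half_open_cube a l"
proof (intro equalityI subsetI)
  fix Q assume "Q \<in> dyadic_generation k (half_open_cube a l)"
  then obtain m where m: "\<forall>i. 0 \<le> m $ i \<and> m $ i < 2 ^ k" and Q: "Q = cell a l k m"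
    unfolding dyadic_generation_half_open_cube[OF assms] by blast
  have "corner a l k m \<in> half_open_cube a l"
    using m mem_half_open_cube_iff_idx[OF assms, of "corner a l k m" a k] by (simp add: idx_corner_self[OF assms])
  then show "Q \<in> (\<lambda>x. cell a l k (idx a l k x)) ` half_open_cube a l"
    unfolding Q by (intro image_eqI[of _ _ "corner a l k m"]) (simp_all add: idx_corner_self[OF assms])
next
  fix Q assume "Q \<in> (\<lambda>x. cell a l k (idx a l k x)) ` half_open_cube a l"
  then show "Q \<in> dyadic_generation k (half_open_cube a l)"
    unfolding dyadic_generation_half_open_cube[OF assms]
    using mem_half_open_cube_iff_idx[OF assms, of _ a k] by blast
qed

text \<open>The coarse address is the fine one divided by \<open>2 ^ j\<close> and rounded
  down.\<close>

lemma idx_mono: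
  assumes "0 < l" "idx a l (k + j) x = idx a l (k + j) y"
  shows "idx a l k x = idx a l k y"
proof -
  have "idx a l k x $ i = idx a l (k + j) x $ i div 2 ^ j" for x i
  proof -
    have "\<lfloor>(x $ i - a $ i) * 2 ^ k / l\<rfloor> = \<lfloor>((x $ i - a $ i) * 2 ^ (k + j) / l) / of_int (2 ^ j)\<rfloor>"
      by (simp add: power_add)
    also have "\<dots> = \<lfloor>(x $ i - a $ i) * 2 ^ (k + j) / l\<rfloor> div 2 ^ j"
      by (rule floor_divide_real_eq_div) simp
    finally show ?thesis by (simp add: idx_def)
  qed
  then show ?thesis using assms(2) by (simp add: vec_eq_iff)
qed

lemma hits_antimono:
  assumes "0 < l" "hits E a l k x" "j \<le> k"
  shows "hits E a l j x"
proof -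
  have "idx a l j y = idx a l j x" if "idx a l k y = idx a l k x" for y
    using that assms(3) by (intro idx_mono[OF assms(1), of a j "k - j"]) simp
  then show ?thesis
    using assms(2) unfolding hits_def by blast
qed

lemma cell_idx_inter_iff_hits: "cell a l k (idx a l k x) \<inter> E \<noteq> {} \<longleftrightarrow> hits E a l k x"
  by (auto simp: cell_def hits_def)

lemma cell_level_inject:
  assumes "0 < l" "cell a l k m = cell a l j n"
  shows "k = j \<and> m = n"
proof -
  have "corner a l k m = corner a l j n \<and> l / 2 ^ k = l / 2 ^ j"
    using assms by (intro half_open_cube_inject) (simp_all add: cell_eq_half_open_cube)
  then have "corner a l k m = corner a l j n" "k = j"
    using assms(1) by (auto simp: field_simps)
  then show ?thesis
    using idx_corner_self[OF assms(1)] by metis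
qed

text \<open>The address \<open>m\<close> is arbitrary, so the cell may lie outside the base cube. A
  lattice cube around one of its points and the base cube have a common ancestor \<open>P\<close>;
  in the grid of \<open>P\<close> the cell is a descendant of \<open>P\<close>, because it contains
  a point of \<open>P\<close>.\<close>

lemma lattice_cell:
  fixes D :: "(real ^ 'd::finite) set set"
  assumes D: "dyadic_lattice D" and "0 < l" and R: "half_open_cube a l \<in> D"
  shows "cell a l k m \<in> D"
proof -
  define x where "x = corner a l k m"
  have m: "m = idx a l k x"
    by (simp add: x_def idx_corner_self[OF \<open>0 < l\<close>])
  obtain P1 where "P1 \<in> D" "x \<in> P1"
    using D compact_sing[of x] unfolding dyadic_lattice_def by (metis insert_subset)
  then obtain P where P: "P \<in> D" "P1 \<in> dyadic_cubes P" "half_open_cube a l \<in> dyadic_cubes P"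
    using D R unfolding dyadic_lattice_def by metis
  then obtain b t where t: "0 < t" and Pb: "P = half_open_cube b t"
    using D unfolding dyadic_lattice_def is_cube_def by metis
  obtain j1 y where "y \<in> P" "P1 = cell b t j1 (idx b t j1 y)"
    using P(2) t unfolding dyadic_cubes_def Pb by (auto simp: dyadic_generation_eq_image)
  with \<open>x \<in> P1\<close> have xP: "x \<in> P"
    using mem_half_open_cube_iff_idx[OF t, of _ b j1] by (simp add: Pb cell_def)
  obtain j z where "half_open_cube a l = cell b t j (idx b t j z)"
    using P(3) t unfolding dyadic_cubes_def Pb by (auto simp: dyadic_generation_eq_image)
  then have "a = corner b t j (idx b t j z) \<and> l = t / 2 ^ j"
    using t \<open>0 < l\<close> by (intro half_open_cube_inject) (simp_all add: cell_eq_half_open_cube)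
  then have "cell a l k m = cell b t (j + k) (idx b t (j + k) x)"
    using cell_idx_corner[OF t] unfolding m by metis
  also have "\<dots> \<in> dyadic_generation (j + k) P"
    unfolding Pb dyadic_generation_eq_image[OF t] using xP Pb by blast
  finally show ?thesis
    using D P(1) unfolding dyadic_lattice_def dyadic_cubes_def by blast
qed

text \<open>For uniqueness, any other candidate is placed together with the base cube in a common
  ancestor. In that single grid the child determines the level, and the fine address determines the
  coarse one.\<close>

lemma parent_cell:
  fixes D :: "(real ^ 'd::finite) set set"
  assumes D: "dyadic_lattice D" and l: "0 < l" and R: "half_open_cube a l \<in> D"
  shows "parent D (cell a l (Suc k) (idx a l (Suc k) x)) = cell a l k (idx a l k x)"
proof -
  let ?Q = "cell a l (Suc k) (idx a l (Suc k) x)" and ?P = "cell a l k (idx a l k x)"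
  have gen: "?Q \<in> dyadic_generation 1 ?P"
  proof -
    have "l / 2 ^ k > 0" using l by simp
    from dyadic_generation_eq_image[OF this, of 1 "corner a l k (idx a l k x)"]
    have "dyadic_generation 1 ?P = (\<lambda>y. cell a l (Suc k) (idx a l (Suc k) y)) ` ?P"
      unfolding cell_idx_corner[OF l] by (simp add: cell_eq_half_open_cube[OF l])
    then show ?thesis by (auto simp: cell_def)
  qed
  show ?thesis
    unfolding parent_def
  proof (rule the_equality)
    show "?P \<in> D \<and> ?Q \<in> dyadic_generation 1 ?P"
      using lattice_cell[OF assms] gen by blast
    fix P' assume P': "P' \<in> D \<and> ?Q \<in> dyadic_generation 1 P'"
    obtain T where T: "T \<in> D" "P' \<in> dyadic_cubes T" "half_open_cube a l \<in> dyadic_cubes T"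
      using D R P' unfolding dyadic_lattice_def by metis
    then obtain b t where t: "0 < t" and Tb: "T = half_open_cube b t"
      using D unfolding dyadic_lattice_def is_cube_def by metis
    obtain j z where "half_open_cube a l = cell b t j (idx b t j z)"
      using T(3) t unfolding dyadic_cubes_def Tb by (auto simp: dyadic_generation_eq_image)
    then have al: "a = corner b t j (idx b t j z) \<and> l = t / 2 ^ j"
      using t l by (intro half_open_cube_inject) (simp_all add: cell_eq_half_open_cube)
    have conv: "cell a l i (idx a l i y) = cell b t (j + i) (idx b t (j + i) y)" for i y
      using cell_idx_corner[OF t] al by metis
    obtain j' y where P'eq: "P' = cell b t j' (idx b t j' y)"
      using T(2) t unfolding dyadic_cubes_def Tb by (auto simp: dyadic_generation_eq_image)
    have "t / 2 ^ j' > 0" using t by simp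
    from dyadic_generation_eq_image[OF this, of 1 "corner b t j' (idx b t j' y)"]
    have "dyadic_generation 1 P' = (\<lambda>y. cell b t (Suc j') (idx b t (Suc j') y)) ` P'"
      unfolding cell_idx_corner[OF t] by (simp add: cell_eq_half_open_cube[OF t] P'eq)
    then obtain u where u: "u \<in> P'" "?Q = cell b t (Suc j') (idx b t (Suc j') u)"
      using P' by auto
    with conv have "cell b t (j + Suc k) (idx b t (j + Suc k) x) = cell b t (Suc j') (idx b t (Suc j') u)"
      by simp
    from cell_level_inject[OF t this] have "j' = j + k" "idx b t (j' + 1) x = idx b t (j' + 1) u"
      by auto
    moreover from this(2) have "idx b t j' x = idx b t j' u"
      by (rule idx_mono[OF t])
    ultimately show "P' = ?P"
      using u(1) conv[of k x] unfolding P'eq by (simp add: cell_def)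
  qed
qed

section \<open>Sums over cubes as integrals\<close>

lemma half_open_cube_borel: "half_open_cube a l \<in> sets borel"
proof -
  have "half_open_cube a l = (\<Inter>i. {x. a $ i \<le> x $ i} \<inter> {x. x $ i < a $ i + l})"
    by (auto simp: half_open_cube_def)
  also have "\<dots> \<in> sets borel"
    by (intro sets.finite_INT sets.Int borel_closed borel_open closed_Collect_le open_Collect_less
        continuous_intros) auto
  finally show ?thesis .
qed

lemma half_open_cube_lebesgue [measurable]: "half_open_cube a l \<in> sets lebesgue"
  using half_open_cube_borel[of a l] by (intro sets_completionI_sets) simp

lemma emeasure_half_open_cube:
  fixes a :: "real ^ 'd::finite"
  assumes "0 \<le> l"
  shows "emeasure lebesgue (half_open_cube a l) = ennreal (l ^ CARD('d))"
proof (rule antisym)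
  define b where "b = (\<chi> i. a $ i + l)"
  have P: "(\<Prod>i\<in>Basis. (b - a) \<bullet> i) = l ^ CARD('d)"
  proof -
    have "(\<Prod>i\<in>Basis. (b - a) \<bullet> i) = (\<Prod>i\<in>(Basis :: (real ^ 'd) set). l)"
      by (intro prod.cong refl) (auto simp: Basis_vec_def inner_axis b_def)
    then show ?thesis by simp
  qed
  have le: "a \<bullet> i \<le> b \<bullet> i" if "i \<in> Basis" for i
    using that assms by (auto simp: Basis_vec_def inner_axis b_def)
  have "half_open_cube a l \<subseteq> cbox a b"
    by (force simp: half_open_cube_def mem_box_cart b_def intro: less_imp_le)
  then have "emeasure lebesgue (half_open_cube a l) \<le> emeasure lebesgue (cbox a b)"
    by (intro emeasure_mono) auto
  also have "\<dots> = ennreal (l ^ CARD('d))"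
    by (simp add: emeasure_lborel_cbox[OF le] P)
  finally show "emeasure lebesgue (half_open_cube a l) \<le> ennreal (l ^ CARD('d))" .
  have "ennreal (l ^ CARD('d)) = emeasure lebesgue (box a b)"
    by (simp add: emeasure_lborel_box[OF le] P)
  also have "\<dots> \<le> emeasure lebesgue (half_open_cube a l)"
    by (intro emeasure_mono half_open_cube_lebesgue)
      (auto simp: half_open_cube_def mem_box_cart b_def intro: less_imp_le)
  finally show "ennreal (l ^ CARD('d)) \<le> emeasure lebesgue (half_open_cube a l)" .
qed

lemma measure_half_open_cube:
  fixes a :: "real ^ 'd::finite"
  assumes "0 \<le> l"
  shows "measure lebesgue (half_open_cube a l) = l ^ CARD('d)"
  unfolding measure_def emeasure_half_open_cube[OF assms] using assms by simp

text \<open>The constant density on a cube of level \<open>k\<close> whose integral over the cube is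
  its scaled volume.\<close>

definition rate :: "real \<Rightarrow> real \<Rightarrow> nat \<Rightarrow> ennreal" where
  "rate \<alpha> l k = ennreal ((l / 2 ^ k) powr - \<alpha>)"

lemma measure_half_open_cube_powr:
  fixes a :: "real ^ 'd::finite"
  assumes "0 < l"
  shows "measure lebesgue (half_open_cube a l) powr (- \<alpha> / real CARD('d)) = l powr - \<alpha>"
  using assms by (simp add: measure_half_open_cube powr_powr flip: powr_realpow)

lemma scaled_volume_half_open_cube:
  fixes a :: "real ^ 'd::finite"
  assumes "0 < l"
  shows "scaled_volume \<alpha> (half_open_cube a l) = rate \<alpha> l 0 * emeasure lebesgue (half_open_cube a l)"
proof -
  have "measure lebesgue (half_open_cube a l) powr (1 - \<alpha> / real CARD('d)) = l powr - \<alpha> * l ^ CARD('d)"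
    unfolding measure_half_open_cube_powr[OF assms, of a \<alpha>, symmetric] using assms
    by (simp add: measure_half_open_cube powr_diff powr_minus divide_inverse mult.commute)
  then show ?thesis
    unfolding scaled_volume_def rate_def emeasure_half_open_cube[OF less_imp_le[OF assms]]
    using assms by (simp add: ennreal_mult)
qed

text \<open>The density is written through the measure instead of the side, so that it is a function
  of the cube as a set and fits a sum indexed by sets.\<close>

lemma scaled_volume_eq_nn_integral:
  fixes a :: "real ^ 'd::finite"
  assumes "0 < l"
  shows "scaled_volume \<alpha> (half_open_cube a l) = (\<integral>\<^sup>+x\<in>half_open_cube a l.
    ennreal (measure lebesgue (half_open_cube a l) powr (- \<alpha> / real CARD('d))) \<partial>lebesgue)"
  unfolding scaled_volume_half_open_cube[OF assms] measure_half_open_cube_powr[OF assms]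
  by (simp add: nn_integral_cmult_indicator rate_def del: emeasure_completion)

section \<open>Interchanging sums over cubes with integrals over points\<close>

lemma infsum_ennreal_eq_nn_integral:
  fixes f :: "'a \<Rightarrow> ennreal"
  assumes "countable A"
  shows "infsum f A = (\<integral>\<^sup>+x. f x \<partial>count_space A)"
proof (rule antisym)
  have S: "infsum f A = (SUP F\<in>{F. finite F \<and> F \<subseteq> A}. sum f F)"
    by (rule nonneg_infsum_complete) simp
  show "infsum f A \<le> (\<integral>\<^sup>+x. f x \<partial>count_space A)"
    unfolding S
  proof (intro SUP_least, safe)
    fix F assume F: "finite F" "F \<subseteq> A"
    have "sum f F = (\<integral>\<^sup>+x. f x * indicator F x \<partial>count_space A)"
      using F by (subst nn_integral_count_space'[of F]) (auto intro!: sum.cong)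
    also have "\<dots> \<le> (\<integral>\<^sup>+x. f x \<partial>count_space A)"
      by (intro nn_integral_mono) (auto simp: indicator_def)
    finally show "sum f F \<le> (\<integral>\<^sup>+x. f x \<partial>count_space A)" .
  qed
  show "(\<integral>\<^sup>+x. f x \<partial>count_space A) \<le> infsum f A"
  proof (cases "finite A")
    case True
    then show ?thesis by (simp add: nn_integral_count_space_finite)
  next
    case False
    note b = bij_betw_from_nat_into[OF assms False]
    have "(\<integral>\<^sup>+x. f x \<partial>count_space A) = (\<Sum>n. f (from_nat_into A n))"
      by (simp add: nn_integral_bij_count_space[symmetric, OF b] nn_integral_count_space_nat)
    also have "\<dots> = (SUP n. \<Sum>i<n. f (from_nat_into A i))"
      by (rule suminf_eq_SUP)
    also have "\<dots> \<le> infsum f A"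
    proof (rule SUP_least)
      fix n
      have "(\<Sum>i<n. f (from_nat_into A i)) = sum f (from_nat_into A ` {..<n})"
        using b by (subst sum.reindex) (auto simp: bij_betw_def inj_on_def)
      also have "\<dots> \<le> infsum f A"
        unfolding S using b by (intro SUP_upper) (auto simp: bij_betw_def)
      finally show "(\<Sum>i<n. f (from_nat_into A i)) \<le> infsum f A" .
    qed
    finally show ?thesis .
  qed
qed

lemma idx_vimage_lebesgue:
  assumes "0 < l"
  shows "{x. idx a l k x \<in> M} \<in> sets lebesgue"
proof -
  have "{x. idx a l k x \<in> M} = (\<Union>m\<in>M. cell a l k m)"
    by (auto simp: cell_def)
  also have "\<dots> \<in> sets lebesgue"
    using assms by (intro sets.countable_UN' uncountable_def[THEN iffD2])
      (auto simp: cell_eq_half_open_cube)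
  finally show ?thesis .
qed

lemma hits_lebesgue:
  assumes "0 < l"
  shows "{x. hits E a l k x} \<in> sets lebesgue"
proof -
  have "{x. hits E a l k x} = {x. idx a l k x \<in> idx a l k ` E}"
    by (auto simp: hits_def intro: rev_image_eqI)
  then show ?thesis
    using idx_vimage_lebesgue[OF assms] by metis
qed

lemma cell_lebesgue:
  assumes "0 < l"
  shows "cell a l k m \<in> sets lebesgue"
  using assms by (simp add: cell_eq_half_open_cube)

lemma nn_integral_cells:
  assumes "0 < l" and f: "f \<in> borel_measurable lebesgue"
  shows "(\<integral>\<^sup>+x\<in>{x. idx a l k x \<in> M}. f x \<partial>lebesgue) =
    (\<integral>\<^sup>+m. (\<integral>\<^sup>+x\<in>cell a l k m. f x \<partial>lebesgue) \<partial>count_space M)"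
proof -
  have "(\<integral>\<^sup>+x\<in>{x. idx a l k x \<in> M}. f x \<partial>lebesgue) =
      (\<integral>\<^sup>+x. (\<integral>\<^sup>+m. f x * indicator (cell a l k m) x \<partial>count_space M) \<partial>lebesgue)"
  proof (intro nn_integral_cong)
    fix x
    have "(\<integral>\<^sup>+m. f x * indicator (cell a l k m) x \<partial>count_space M)
        = (\<Sum>m\<in>{idx a l k x} \<inter> M. f x * indicator (cell a l k m) x)"
      by (intro nn_integral_count_space') (auto simp: cell_def)
    also have "\<dots> = f x * indicator {x. idx a l k x \<in> M} x"
      by (auto simp: cell_def indicator_def)
    finally show "f x * indicator {x. idx a l k x \<in> M} x =
      (\<integral>\<^sup>+m. f x * indicator (cell a l k m) x \<partial>count_space M)" ..
  qed
  also have "\<dots> = (\<integral>\<^sup>+m. (\<integral>\<^sup>+x\<in>cell a l k m. f x \<partial>lebesgue) \<partial>count_space M)"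
    using f cell_lebesgue[OF assms(1)]
    by (intro nn_integral_count_space_nn_integral borel_measurable_times_ennreal borel_measurable_indicator) auto
  finally show ?thesis .
qed

lemma nn_integral_cells_mono:
  assumes "0 < l" and f: "f \<in> borel_measurable lebesgue" and g: "g \<in> borel_measurable lebesgue"
    and le: "\<And>m. m \<in> M \<Longrightarrow> (\<integral>\<^sup>+x\<in>cell a l k m. f x \<partial>lebesgue) \<le> (\<integral>\<^sup>+x\<in>cell a l k m. g x \<partial>lebesgue)"
  shows "(\<integral>\<^sup>+x\<in>{x. idx a l k x \<in> M}. f x \<partial>lebesgue) \<le> (\<integral>\<^sup>+x\<in>{x. idx a l k x \<in> M}. g x \<partial>lebesgue)"
  unfolding nn_integral_cells[OF assms(1) f] nn_integral_cells[OF assms(1) g]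
  by (rule nn_integral_mono) (use le in simp)

lemma dyadic_cubes_subset:
  assumes "0 < l" "Q \<in> dyadic_cubes (half_open_cube a l)"
  shows "Q \<subseteq> half_open_cube a l"
proof
  fix x assume "x \<in> Q"
  obtain k m where "\<forall>i. 0 \<le> m $ i \<and> m $ i < 2 ^ k" "Q = cell a l k m"
    using assms(2) unfolding dyadic_cubes_def dyadic_generation_half_open_cube[OF assms(1)] by blast
  with \<open>x \<in> Q\<close> show "x \<in> half_open_cube a l"
    unfolding mem_half_open_cube_iff_idx[OF assms(1), of x a k] by (simp add: cell_def)
qed

lemma countable_dyadic_cubes:
  assumes "0 < l"
  shows "countable (dyadic_cubes (half_open_cube a l))"
proof (rule countable_subset)
  show "dyadic_cubes (half_open_cube a l) \<subseteq> (\<Union>k. range (cell a l k))"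
    unfolding dyadic_cubes_def dyadic_generation_half_open_cube[OF assms] by blast
qed auto

text \<open>Tonelli with respect to counting measure on \<open>S\<close>: at a fixed point at most
  one cube of each level contributes. The integrand may depend on the cube as well as on the point,
  which covers both scaled volumes and weights.\<close>

lemma infsum_cubes_eq_nn_integral:
  fixes a :: "real ^ 'd::finite" and f :: "(real ^ 'd) set \<Rightarrow> real ^ 'd \<Rightarrow> ennreal"
  assumes l: "0 < l" and S: "S \<subseteq> dyadic_cubes (half_open_cube a l)"
    and f: "\<And>Q. f Q \<in> borel_measurable lebesgue"
  shows "(\<Sum>\<^sub>\<infinity>Q\<in>S. \<integral>\<^sup>+x\<in>Q. f Q x \<partial>lebesgue) =
    (\<integral>\<^sup>+x\<in>half_open_cube a l. (\<Sum>k. if cell a l k (idx a l k x) \<in> S then f (cell a l k (idx a l k x)) x else 0) \<partial>lebesgue)"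
proof -
  have cells: "\<exists>k m. Q = cell a l k m" if "Q \<in> S" for Q
    using that S unfolding dyadic_cubes_def dyadic_generation_eq_image[OF l] by blast
  have sub: "Q \<subseteq> half_open_cube a l" if "Q \<in> S" for Q
    using that S dyadic_cubes_subset[OF l] by blast
  have meas: "Q \<in> sets lebesgue" if "Q \<in> S" for Q
    using cells[OF that] cell_lebesgue[OF l] by blast
  have cS: "countable S"
    by (rule countable_subset[OF S countable_dyadic_cubes[OF l]])
  have "(\<Sum>\<^sub>\<infinity>Q\<in>S. \<integral>\<^sup>+x\<in>Q. f Q x \<partial>lebesgue) = (\<integral>\<^sup>+Q. (\<integral>\<^sup>+x\<in>Q. f Q x \<partial>lebesgue) \<partial>count_space S)"
    by (rule infsum_ennreal_eq_nn_integral[OF cS])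
  also have "\<dots> = (\<integral>\<^sup>+x. (\<integral>\<^sup>+Q. f Q x * indicator Q x \<partial>count_space S) \<partial>lebesgue)"
    using f meas
    by (intro nn_integral_count_space_nn_integral[symmetric] cS borel_measurable_times_ennreal
        borel_measurable_indicator)
  also have "\<dots> = (\<integral>\<^sup>+x\<in>half_open_cube a l. (\<Sum>k. if cell a l k (idx a l k x) \<in> S then f (cell a l k (idx a l k x)) x else 0) \<partial>lebesgue)"
  proof (intro nn_integral_cong)
    fix x
    let ?Q = "\<lambda>k. cell a l k (idx a l k x)"
    show "(\<integral>\<^sup>+Q. f Q x * indicator Q x \<partial>count_space S) =
      (\<Sum>k. if ?Q k \<in> S then f (?Q k) x else 0) * indicator (half_open_cube a l) x"
    proof (cases "x \<in> half_open_cube a l")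
      case False
      then have "f Q x * indicator Q x = 0" if "Q \<in> S" for Q
        using sub[OF that] by (auto simp: indicator_def)
      then have "(\<integral>\<^sup>+Q. f Q x * indicator Q x \<partial>count_space S) = (\<integral>\<^sup>+Q. 0 \<partial>count_space S)"
        by (intro nn_integral_cong) (simp only: space_count_space)
      then show ?thesis
        using False by simp
    next
      case True
      \<comment> \<open>The cubes of \<open>S\<close> containing \<open>x\<close> correspond to
        their levels, since the side determines the level and \<open>x\<close> determines the
        address.\<close>
      have bij: "bij_betw ?Q {k. ?Q k \<in> S} {Q \<in> S. x \<in> Q}"
        unfolding bij_betw_def
      proof
        show "inj_on ?Q {k. ?Q k \<in> S}"
          using cell_level_inject[OF l] by (intro inj_onI) blast
        show "?Q ` {k. ?Q k \<in> S} = {Q \<in> S. x \<in> Q}"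
          using cells by (fastforce simp: cell_def)
      qed
      have "(\<integral>\<^sup>+Q. f Q x * indicator Q x \<partial>count_space S) = (\<integral>\<^sup>+Q. f Q x \<partial>count_space {Q \<in> S. x \<in> Q})"
        by (simp add: nn_integral_count_space_indicator indicator_def)
          (auto intro!: nn_integral_cong)
      also have "\<dots> = (\<integral>\<^sup>+k. f (?Q k) x \<partial>count_space {k. ?Q k \<in> S})"
        by (rule nn_integral_bij_count_space[OF bij, symmetric])
      also have "\<dots> = (\<integral>\<^sup>+k. (if ?Q k \<in> S then f (?Q k) x else 0) \<partial>count_space UNIV)"
        by (simp add: nn_integral_count_space_indicator indicator_def)
          (auto intro!: nn_integral_cong)
      also have "\<dots> = (\<Sum>k. if ?Q k \<in> S then f (?Q k) x else 0)"
        by (rule nn_integral_count_space_nat)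
      finally show ?thesis
        using True by simp
    qed
  qed
  finally show ?thesis .
qed

section \<open>Distance to the set and nested cubes\<close>

lemma infnorm_le_cart:
  fixes x :: "real ^ 'd::finite"
  assumes "\<And>i. \<bar>x $ i\<bar> \<le> c"
  shows "infnorm x \<le> c"
  unfolding infnorm_cart using assms by (intro cSup_least) auto

lemma bdd_below_infnorm_image: "bdd_below ((\<lambda>y. infnorm (x - y)) ` E)"
  by (rule bdd_belowI[of _ 0]) (auto simp: infnorm_pos_le)

lemma max_dist_nonneg: "E \<noteq> {} \<Longrightarrow> 0 \<le> max_dist x E"
  unfolding max_dist_def by (rule cINF_greatest) (auto simp: infnorm_pos_le)

lemma max_dist_le: "y \<in> E \<Longrightarrow> max_dist x E \<le> infnorm (x - y)"
  unfolding max_dist_def by (rule cINF_lower[OF bdd_below_infnorm_image])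

lemma max_dist_less_iff:
  "E \<noteq> {} \<Longrightarrow> max_dist x E < c \<longleftrightarrow> (\<exists>y\<in>E. infnorm (x - y) < c)"
  unfolding max_dist_def by (rule cINF_less_iff[OF _ bdd_below_infnorm_image])

lemma continuous_on_max_dist:
  fixes E :: "(real ^ 'd::finite) set"
  assumes "E \<noteq> {}"
  shows "continuous_on UNIV (\<lambda>x. max_dist x E)"
proof -
  have le: "max_dist x E \<le> max_dist y E + dist x y" for x y
  proof -
    have "max_dist x E - dist x y \<le> infnorm (y - z)" if "z \<in> E" for z
    proof -
      have "max_dist x E \<le> infnorm (x - z)"
        using that by (rule max_dist_le)
      also have "\<dots> \<le> infnorm (x - y) + infnorm (y - z)"
        using infnorm_triangle[of "x - y" "y - z"] by simp
      finally show ?thesis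
        using infnorm_le_norm[of "x - y"] by (simp add: dist_norm)
    qed
    then have "max_dist x E - dist x y \<le> max_dist y E"
      using assms unfolding max_dist_def[of y] by (intro cINF_greatest) auto
    then show ?thesis by simp
  qed
  show ?thesis
  proof (intro continuous_onI)
    fix x :: "real ^ 'd" and e :: real assume "0 < e"
    have "\<bar>max_dist y E - max_dist x E\<bar> \<le> dist y x" for y
      using le[of y x] le[of x y] by (simp add: dist_commute)
    then show "\<exists>d>0. \<forall>y\<in>UNIV. dist y x < d \<longrightarrow> dist (max_dist y E) (max_dist x E) \<le> e"
      using \<open>0 < e\<close> by (intro exI[of _ e]) (auto simp: dist_real_def intro: order.trans less_imp_le)
  qed
qed

lemma max_dist_measurable:
  fixes E :: "(real ^ 'd::finite) set"
  assumes "E \<noteq> {}"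
  shows "(\<lambda>x. max_dist x E) \<in> borel_measurable lebesgue"
  using continuous_on_max_dist[OF assms]
  by (intro measurable_completion) (simp add: borel_measurable_continuous_onI)

lemma max_dist_pos:
  fixes E :: "(real ^ 'd::finite) set"
  assumes "E \<noteq> {}" "x \<notin> closure E"
  shows "0 < max_dist x E"
proof (rule ccontr)
  assume "\<not> 0 < max_dist x E"
  then have le: "max_dist x E \<le> 0" by simp
  have "\<exists>y\<in>E. dist y x < e" if "0 < e" for e
  proof -
    \<comment> \<open>The closure refers to the Euclidean norm, \<open>max_dist\<close> to the
      maximum norm; \<open>s\<close> is the constant comparing the two.\<close>
    define s where "s = sqrt (DIM(real ^ 'd))"
    have s: "0 < s" by (simp add: s_def)
    have "max_dist x E < e / s"
      using le s that by (simp add: le_less_trans[OF le])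
    then obtain y where "y \<in> E" "infnorm (x - y) < e / s"
      using max_dist_less_iff[OF assms(1)] by blast
    moreover have "norm (x - y) \<le> s * infnorm (x - y)"
      unfolding s_def by (rule norm_le_infnorm)
    ultimately show ?thesis
      using s by (intro bexI[of _ y]) (auto simp: dist_norm norm_minus_commute field_simps)
  qed
  with assms(2) show False
    unfolding closure_approachable by blast
qed

lemma max_dist_le_if_hits:
  fixes E :: "(real ^ 'd::finite) set"
  assumes "0 < l" "hits E a l k x"
  shows "max_dist x E \<le> l / 2 ^ k"
proof -
  obtain y where y: "y \<in> E" "idx a l k y = idx a l k x"
    using assms(2) unfolding hits_def by blast
  have "\<bar>(x - y) $ i\<bar> \<le> l / 2 ^ k" for i
    using idx_nth_eq_iff[OF assms(1), of a k x i "idx a l k x $ i"]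
      idx_nth_eq_iff[OF assms(1), of a k y i "idx a l k x $ i"] y(2)
    by (simp add: distrib_right add_divide_distrib abs_le_iff)
  then have "infnorm (x - y) \<le> l / 2 ^ k"
    by (rule infnorm_le_cart)
  then show ?thesis
    using max_dist_le[OF y(1), of x] by linarith
qed

lemma dist_weight_measurable:
  fixes E :: "(real ^ 'd::finite) set"
  assumes "E \<noteq> {}"
  shows "dist_weight \<alpha> E \<in> borel_measurable lebesgue"
proof (cases "\<alpha> = 0")
  case True
  then have "dist_weight \<alpha> E = (\<lambda>_. 1)" by (simp add: dist_weight_def fun_eq_iff)
  then show ?thesis by simp
next
  case False
  note [measurable] = max_dist_measurable[OF assms]
  have "dist_weight \<alpha> E = (\<lambda>x. 1 / ennreal (max_dist x E powr \<alpha>))"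
    using False by (simp add: dist_weight_def fun_eq_iff)
  also have "\<dots> \<in> borel_measurable lebesgue" by measurable
  finally show ?thesis .
qed

lemma dist_weight_ge:
  assumes "E \<noteq> {}" "0 < \<alpha>" "0 < s" "max_dist x E \<le> s"
  shows "ennreal (s powr - \<alpha>) \<le> dist_weight \<alpha> E x"
proof (cases "max_dist x E = 0")
  \<comment> \<open>The weight is \<open>1 / 0\<close> here, which is infinite in
    \<open>ennreal\<close>.\<close>
  case True
  then show ?thesis using assms by (simp add: dist_weight_def)
next
  case False
  then have pos: "0 < max_dist x E"
    using max_dist_nonneg[OF assms(1), of x] by simp
  have "s powr - \<alpha> \<le> max_dist x E powr - \<alpha>"
    using assms pos by (intro powr_mono2') auto
  then show ?thesis
    using assms pos divide_ennreal[of 1 "max_dist x E powr \<alpha>"]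
    by (simp add: dist_weight_def powr_minus_divide ennreal_leI)
qed

lemma dist_weight_le:
  assumes "0 < \<alpha>" "0 < s" "s \<le> max_dist x E"
  shows "dist_weight \<alpha> E x \<le> ennreal (s powr - \<alpha>)"
proof -
  have "max_dist x E powr - \<alpha> \<le> s powr - \<alpha>"
    using assms by (intro powr_mono2') auto
  then show ?thesis
    using assms divide_ennreal[of 1 "max_dist x E powr \<alpha>"]
    by (simp add: dist_weight_def powr_minus_divide ennreal_leI)
qed

lemma rate_le_dist_weight_if_hits:
  assumes "E \<noteq> {}" "0 < \<alpha>" "0 < l" "hits E a l k x"
  shows "rate \<alpha> l k \<le> dist_weight \<alpha> E x"
  unfolding rate_def using assms max_dist_le_if_hits[of l E a k x] by (intro dist_weight_ge) auto

section \<open>Geometric sums along nested cubes\<close>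

lemma rate_Suc:
  assumes "0 < l"
  shows "rate \<alpha> l (Suc k) = ennreal (2 powr \<alpha>) * rate \<alpha> l k"
proof -
  have "(l / 2 ^ Suc k) powr - \<alpha> = 2 powr \<alpha> * (l / 2 ^ k) powr - \<alpha>"
  proof -
    have "(l / 2 ^ k) powr - \<alpha> = (2 * (l / 2 ^ Suc k)) powr - \<alpha>" by simp
    also have "\<dots> = 2 powr - \<alpha> * (l / 2 ^ Suc k) powr - \<alpha>"
      using assms by (subst powr_mult) auto
    finally show ?thesis by (simp add: powr_minus field_simps)
  qed
  then show ?thesis by (simp add: rate_def ennreal_mult)
qed

text \<open>The terms grow by the factor \<open>q = 2 powr \<alpha>\<close>, and the induction step
  is \<open>1 / (q - 1) + 1 = q / (q - 1)\<close>. The requirement \<open>q > 1\<close> is what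
  restricts the comparison to \<alpha> > 0.\<close>

lemma sum_rate_le:
  assumes "0 < l" "0 < \<alpha>"
  shows "(\<Sum>k<n. rate \<alpha> l k) \<le> ennreal (1 / (2 powr \<alpha> - 1)) * rate \<alpha> l n"
proof (induction n)
  case (Suc n)
  have q: "1 < 2 powr \<alpha>" using assms(2) powr_less_mono[of 0 \<alpha> 2] by simp
  have "(\<Sum>k<Suc n. rate \<alpha> l k) \<le> ennreal (1 / (2 powr \<alpha> - 1)) * rate \<alpha> l n + rate \<alpha> l n"
    using Suc by (simp add: add_right_mono)
  also have "\<dots> = (ennreal (1 / (2 powr \<alpha> - 1)) + 1) * rate \<alpha> l n"
    by (simp add: distrib_right)
  also have "ennreal (1 / (2 powr \<alpha> - 1)) + 1 = ennreal (1 / (2 powr \<alpha> - 1) + 1)"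
    using q by (simp add: ennreal_plus)
  also have "1 / (2 powr \<alpha> - 1) + 1 = 1 / (2 powr \<alpha> - 1) * 2 powr \<alpha>"
    using q assms(2) by (simp add: divide_simps)
  also have "ennreal (1 / (2 powr \<alpha> - 1) * 2 powr \<alpha>) = ennreal (1 / (2 powr \<alpha> - 1)) * ennreal (2 powr \<alpha>)"
    by (rule ennreal_mult) (use q in auto)
  finally show ?case
    by (simp only: rate_Suc[OF assms(1)] mult.assoc)
qed simp

lemma eventually_not_hits:
  fixes E :: "(real ^ 'd::finite) set"
  assumes "E \<noteq> {}" "0 < l" "x \<notin> closure E"
  shows "\<exists>k. \<not> hits E a l k x"
proof -
  have pos: "0 < max_dist x E" by (rule max_dist_pos[OF assms(1,3)])
  obtain k where "l / max_dist x E < 2 ^ k"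
    using real_arch_pow[of 2] by auto
  then have "l / 2 ^ k < max_dist x E"
    using pos by (simp add: field_simps)
  then show ?thesis
    using max_dist_le_if_hits[OF assms(2)] by (meson not_less)
qed

text \<open>The levels hit form an initial segment because ancestors of meeting cubes meet
  \<open>E\<close>, and a finite one because a cube meeting \<open>E\<close> has side at least the
  positive distance of \<open>x\<close> to \<open>E\<close>.\<close>

lemma first_missed_level:
  fixes E :: "(real ^ 'd::finite) set"
  assumes "E \<noteq> {}" "0 < l" "x \<notin> closure E"
  obtains n where "\<And>k. hits E a l k x \<longleftrightarrow> k < n"
proof -
  define n where "n = (LEAST k. \<not> hits E a l k x)"
  have "\<not> hits E a l n x"
    unfolding n_def using eventually_not_hits[OF assms] by (rule LeastI_ex)
  then have "\<not> hits E a l k x" if "n \<le> k" for k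
    using hits_antimono[OF assms(2) _ that] by blast
  moreover have "hits E a l k x" if "k < n" for k
    using not_less_Least[of k "\<lambda>k. \<not> hits E a l k x"] that unfolding n_def by blast
  ultimately have "hits E a l k x \<longleftrightarrow> k < n" for k
    by (meson not_less)
  then show thesis by (rule that)
qed

lemma sum_hits_le_first_missed:
  fixes E :: "(real ^ 'd::finite) set"
  assumes "E \<noteq> {}" "0 < l" "0 < \<alpha>" "x \<notin> closure E" "hits E a l 0 x"
  shows "(\<Sum>k. if hits E a l k x then rate \<alpha> l k else 0) \<le> ennreal (1 / (2 powr \<alpha> - 1)) *
     (\<Sum>k. if 0 < k \<and> \<not> hits E a l k x \<and> hits E a l (k - 1) x then rate \<alpha> l k else 0)"
proof -
  obtain n where n: "\<And>k. hits E a l k x \<longleftrightarrow> k < n"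
    using first_missed_level[OF assms(1,2,4)] by blast
  have "0 < n" using n assms(5) by blast
  have "(\<Sum>k. if hits E a l k x then rate \<alpha> l k else 0) = (\<Sum>k<n. rate \<alpha> l k)"
    unfolding n by (subst suminf_finite[of "{..<n}"]) auto
  also have "\<dots> \<le> ennreal (1 / (2 powr \<alpha> - 1)) * rate \<alpha> l n"
    by (rule sum_rate_le[OF assms(2,3)])
  \<comment> \<open>Level \<open>n\<close> is that of the maximal free cube containing
    \<open>x\<close>. It is positive because \<open>hits\<close> is assumed at level 0.\<close>
  also have "rate \<alpha> l n =
     (\<Sum>k\<in>{n}. if 0 < k \<and> \<not> hits E a l k x \<and> hits E a l (k - 1) x then rate \<alpha> l k else 0)"
    using \<open>0 < n\<close> unfolding n by auto
  also have "\<dots> \<le> (\<Sum>k. if 0 < k \<and> \<not> hits E a l k x \<and> hits E a l (k - 1) x then rate \<alpha> l k else 0)"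
    by (intro sum_le_suminf) auto
  finally show ?thesis by (simp add: mult_left_mono)
qed

text \<open>Each maximal free cube is charged to its parent, which meets \<open>E\<close> and whose
  rate is smaller by the factor \<open>2 powr \<alpha>\<close>.\<close>

lemma first_missed_le_sum_hits:
  assumes "0 < l"
  shows "(\<Sum>k. if 0 < k \<and> \<not> hits E a l k x \<and> hits E a l (k - 1) x then rate \<alpha> l k else 0) \<le>
    ennreal (2 powr \<alpha>) * (\<Sum>k. if hits E a l k x then rate \<alpha> l k else 0)"
proof -
  \<comment> \<open>The summand at \<open>k = 0\<close> vanishes, so the series may be shifted by
    one level.\<close>
  have "(\<Sum>k. if 0 < k \<and> \<not> hits E a l k x \<and> hits E a l (k - 1) x then rate \<alpha> l k else 0) =
      (\<Sum>k. if \<not> hits E a l (Suc k) x \<and> hits E a l k x then rate \<alpha> l (Suc k) else 0)"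
    by (subst suminf_offset[where i = 1]) (simp_all cong: if_cong)
  also have "\<dots> \<le> (\<Sum>k. ennreal (2 powr \<alpha>) * (if hits E a l k x then rate \<alpha> l k else 0))"
    by (intro suminf_le) (auto simp: rate_Suc[OF assms])
  finally show ?thesis by simp
qed

text \<open>The sum is dominated by its last term, whose cube contains \<open>x\<close> and a point
  of \<open>E\<close>, so that the distance is at most its side. The numerator
  \<open>2 powr \<alpha>\<close> comes from stepping back from the first missed level to the last
  one hit.\<close>

lemma sum_hits_le_dist_weight:
  fixes E :: "(real ^ 'd::finite) set"
  assumes "E \<noteq> {}" "0 < l" "0 < \<alpha>" "x \<notin> closure E"
  shows "(\<Sum>k. if hits E a l k x then rate \<alpha> l k else 0) \<le>
     ennreal (2 powr \<alpha> / (2 powr \<alpha> - 1)) * dist_weight \<alpha> E x"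
proof -
  obtain n where n: "\<And>k. hits E a l k x \<longleftrightarrow> k < n"
    using first_missed_level[OF assms(1,2,4)] by blast
  have q: "1 < 2 powr \<alpha>" using assms(3) powr_less_mono[of 0 \<alpha> 2] by simp
  have eq: "(\<Sum>k. if hits E a l k x then rate \<alpha> l k else 0) = (\<Sum>k<n. rate \<alpha> l k)"
    unfolding n by (subst suminf_finite[of "{..<n}"]) auto
  show ?thesis
  proof (cases n)
    case (Suc m)
    have "(\<Sum>k<n. rate \<alpha> l k) \<le> ennreal (1 / (2 powr \<alpha> - 1)) * (ennreal (2 powr \<alpha>) * rate \<alpha> l m)"
      using sum_rate_le[OF assms(2,3), of n] by (simp add: Suc rate_Suc[OF assms(2)])
    also have "\<dots> = ennreal (2 powr \<alpha> / (2 powr \<alpha> - 1)) * rate \<alpha> l m"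
      using q by (simp add: ennreal_mult[symmetric] mult.assoc[symmetric])
    also have "\<dots> \<le> ennreal (2 powr \<alpha> / (2 powr \<alpha> - 1)) * dist_weight \<alpha> E x"
      using rate_le_dist_weight_if_hits[OF assms(1,3,2), of a m x] n Suc by (intro mult_left_mono) auto
    finally show ?thesis unfolding eq .
  qed (simp add: eq)
qed

text \<open>If the distance is at least the side of level \<open>n\<close>, the first term suffices.
  Otherwise it lies between the sides of two consecutive levels, and the single summand of the
  coarser one suffices, with \<open>2 powr \<alpha>\<close> paying for the gap. The starting level
  stays free: it is 0 for the volume bound, and large where the deep levels have to be made
  negligible.\<close>

lemma dist_weight_le_sum_near:
  fixes E :: "(real ^ 'd::finite) set"
  assumes "E \<noteq> {}" "0 < l" "0 < \<alpha>" "x \<notin> closure E"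
  shows "dist_weight \<alpha> E x \<le> rate \<alpha> l n + ennreal (2 powr \<alpha>) *
     (\<Sum>k. if max_dist x E < l / 2 ^ (n + k) then rate \<alpha> l (n + k) else 0)"
proof (cases "max_dist x E < l / 2 ^ n")
  case False
  then have "dist_weight \<alpha> E x \<le> rate \<alpha> l n"
    unfolding rate_def using assms by (intro dist_weight_le) auto
  then show ?thesis by (simp add: add_increasing2)
next
  case True
  have pos: "0 < max_dist x E" by (rule max_dist_pos[OF assms(1,4)])
  define m where "m = (LEAST k. l / 2 ^ (n + k) \<le> max_dist x E)"
  have "\<exists>k. l / 2 ^ (n + k) \<le> max_dist x E"
  proof -
    obtain k where k: "l / max_dist x E < 2 ^ k"
      using real_arch_pow[of 2] by auto
    also have "(2 :: real) ^ k \<le> 2 ^ (n + k)" by simp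
    finally show ?thesis
      using pos by (intro exI[of _ k]) (simp add: field_simps)
  qed
  then have m: "l / 2 ^ (n + m) \<le> max_dist x E"
    unfolding m_def by (rule LeastI_ex)
  with True obtain j where j: "m = Suc j"
    by (cases m) auto
  then have less: "max_dist x E < l / 2 ^ (n + j)"
    using not_less_Least[of j "\<lambda>k. l / 2 ^ (n + k) \<le> max_dist x E"] unfolding m_def by simp
  have "dist_weight \<alpha> E x \<le> rate \<alpha> l (Suc (n + j))"
    unfolding rate_def using m assms(2,3) by (intro dist_weight_le) (auto simp: j)
  also have "\<dots> = ennreal (2 powr \<alpha>) * (\<Sum>k\<in>{j}. if max_dist x E < l / 2 ^ (n + k) then rate \<alpha> l (n + k) else 0)"
    using less by (simp add: rate_Suc[OF assms(2)])
  also have "\<dots> \<le> ennreal (2 powr \<alpha>) * (\<Sum>k. if max_dist x E < l / 2 ^ (n + k) then rate \<alpha> l (n + k) else 0)"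
    by (intro mult_left_mono sum_le_suminf) auto
  finally show ?thesis by (simp add: add_increasing)
qed

section \<open>Integral form of the conditions and the triple of a cube\<close>

lemma measurable_hits:
  assumes "0 < l"
  shows "Measurable.pred lebesgue (hits E a l k)"
  using hits_lebesgue[OF assms] by (simp add: pred_def)

lemma measurable_sum_hits:
  assumes "0 < l" and f: "\<And>k. f k \<in> borel_measurable lebesgue"
  shows "(\<lambda>x. \<Sum>k. if hits E a l (n + k) x then f k x else (0 :: ennreal)) \<in> borel_measurable lebesgue"
proof -
  note [measurable] = f measurable_hits[OF assms(1)]
  show ?thesis by measurable
qed

lemma cell_mem_dyadic_cubes:
  assumes "0 < l" "x \<in> half_open_cube a l"
  shows "cell a l k (idx a l k x) \<in> dyadic_cubes (half_open_cube a l)"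
  using assms(2) unfolding dyadic_cubes_def dyadic_generation_eq_image[OF assms(1)] by blast

lemma measure_cell_powr:
  fixes a :: "real ^ 'd::finite"
  assumes "0 < l"
  shows "ennreal (measure lebesgue (cell a l k m) powr (- \<alpha> / real CARD('d))) = rate \<alpha> l k"
  using assms unfolding cell_eq_half_open_cube[OF assms] rate_def
  by (subst measure_half_open_cube_powr) auto

lemma infsum_scaled_volume:
  fixes a :: "real ^ 'd::finite"
  assumes l: "0 < l" and S: "S \<subseteq> dyadic_cubes (half_open_cube a l)"
  shows "(\<Sum>\<^sub>\<infinity>Q\<in>S. scaled_volume \<alpha> Q) = (\<integral>\<^sup>+x\<in>half_open_cube a l.
    (\<Sum>k. if cell a l k (idx a l k x) \<in> S then rate \<alpha> l k else 0) \<partial>lebesgue)"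
proof -
  have "(\<Sum>\<^sub>\<infinity>Q\<in>S. scaled_volume \<alpha> Q) =
    (\<Sum>\<^sub>\<infinity>Q\<in>S. \<integral>\<^sup>+x\<in>Q. ennreal (measure lebesgue Q powr (- \<alpha> / real CARD('d))) \<partial>lebesgue)"
  proof (rule infsum_cong)
    fix Q assume "Q \<in> S"
    then obtain k m where "Q = cell a l k m"
      using S unfolding dyadic_cubes_def dyadic_generation_half_open_cube[OF l] by blast
    then have "Q = half_open_cube (corner a l k m) (l / 2 ^ k)"
      by (simp add: cell_eq_half_open_cube[OF l])
    then show "scaled_volume \<alpha> Q =
      (\<integral>\<^sup>+x\<in>Q. ennreal (measure lebesgue Q powr (- \<alpha> / real CARD('d))) \<partial>lebesgue)"
      using scaled_volume_eq_nn_integral[of "l / 2 ^ k"] l by simp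
  qed
  also have "\<dots> = (\<integral>\<^sup>+x\<in>half_open_cube a l.
    (\<Sum>k. if cell a l k (idx a l k x) \<in> S then rate \<alpha> l k else 0) \<partial>lebesgue)"
    by (subst infsum_cubes_eq_nn_integral[OF l S]) (simp_all add: measure_cell_powr[OF l, simplified] cong: if_cong)
  finally show ?thesis .
qed

lemma cell_mem_meeting_cubes_iff:
  assumes "0 < l" "x \<in> half_open_cube a l"
  shows "cell a l k (idx a l k x) \<in> meeting_cubes E (half_open_cube a l) \<longleftrightarrow> hits E a l k x"
  using cell_mem_dyadic_cubes[OF assms] by (simp add: meeting_cubes_def cell_idx_inter_iff_hits)

text \<open>Among the cubes containing \<open>x\<close>, level 0 is the base cube itself, which is
  excluded from the maximal free cubes; hence \<open>0 < k\<close>, and \<open>k - 1\<close> is the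
  level of the parent.\<close>

lemma cell_mem_maximal_free_cubes_iff:
  assumes "dyadic_lattice D" "0 < l" "half_open_cube a l \<in> D" "x \<in> half_open_cube a l"
  shows "cell a l k (idx a l k x) \<in> maximal_free_cubes D E (half_open_cube a l) \<longleftrightarrow>
    0 < k \<and> \<not> hits E a l k x \<and> hits E a l (k - 1) x"
proof -
  have R: "cell a l 0 (idx a l 0 x) = half_open_cube a l"
    using mem_half_open_cube_iff_idx[OF assms(2), of x a 0] assms(4)
    by (simp add: half_open_cube_eq_cell[OF assms(2)] cell_def)
  show ?thesis
  proof (cases k)
    case 0
    then show ?thesis by (simp add: maximal_free_cubes_def R)
  next
    case (Suc j)
    have "cell a l k (idx a l k x) \<noteq> half_open_cube a l"
      using cell_level_inject[OF assms(2), of a k _ 0] unfolding R[symmetric] Suc by blast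
    then show ?thesis
      using cell_mem_dyadic_cubes[OF assms(2,4), of k] parent_cell[OF assms(1-3), of j x]
      by (simp add: maximal_free_cubes_def Suc flip: cell_idx_inter_iff_hits)
  qed
qed

lemma sum_meeting_volume:
  assumes "0 < l"
  shows "(\<Sum>\<^sub>\<infinity>Q\<in>meeting_cubes E (half_open_cube a l). scaled_volume \<alpha> Q) =
    (\<integral>\<^sup>+x\<in>half_open_cube a l. (\<Sum>k. if hits E a l k x then rate \<alpha> l k else 0) \<partial>lebesgue)"
proof -
  have "meeting_cubes E (half_open_cube a l) \<subseteq> dyadic_cubes (half_open_cube a l)"
    by (auto simp: meeting_cubes_def)
  note infsum_scaled_volume[OF assms this]
  also have "(\<integral>\<^sup>+x\<in>half_open_cube a l. (\<Sum>k. if cell a l k (idx a l k x) \<in> meeting_cubes E (half_open_cube a l)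
        then rate \<alpha> l k else 0) \<partial>lebesgue) =
      (\<integral>\<^sup>+x\<in>half_open_cube a l. (\<Sum>k. if hits E a l k x then rate \<alpha> l k else 0) \<partial>lebesgue)"
    by (intro nn_integral_cong) (auto simp: indicator_def cell_mem_meeting_cubes_iff[OF assms])
  finally show ?thesis .
qed

lemma sum_maximal_free_volume:
  assumes "dyadic_lattice D" "0 < l" "half_open_cube a l \<in> D"
  shows "(\<Sum>\<^sub>\<infinity>Q\<in>maximal_free_cubes D E (half_open_cube a l). scaled_volume \<alpha> Q) =
    (\<integral>\<^sup>+x\<in>half_open_cube a l. (\<Sum>k. if 0 < k \<and> \<not> hits E a l k x \<and> hits E a l (k - 1) x
      then rate \<alpha> l k else 0) \<partial>lebesgue)"
proof -
  have "maximal_free_cubes D E (half_open_cube a l) \<subseteq> dyadic_cubes (half_open_cube a l)"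
    by (auto simp: maximal_free_cubes_def)
  note infsum_scaled_volume[OF assms(2) this]
  also have "(\<integral>\<^sup>+x\<in>half_open_cube a l. (\<Sum>k. if cell a l k (idx a l k x) \<in> maximal_free_cubes D E (half_open_cube a l)
        then rate \<alpha> l k else 0) \<partial>lebesgue) =
      (\<integral>\<^sup>+x\<in>half_open_cube a l. (\<Sum>k. if 0 < k \<and> \<not> hits E a l k x \<and> hits E a l (k - 1) x
      then rate \<alpha> l k else 0) \<partial>lebesgue)"
    by (intro nn_integral_cong) (auto simp: indicator_def cell_mem_maximal_free_cubes_iff[OF assms])
  finally show ?thesis .
qed

lemma sum_meeting_weight:
  assumes "0 < l" "E \<noteq> {}"
  shows "(\<Sum>\<^sub>\<infinity>Q\<in>meeting_cubes E (half_open_cube a l). weight_measure \<alpha> E Q) =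
    (\<integral>\<^sup>+x\<in>half_open_cube a l. (\<Sum>k. if hits E a l k x then dist_weight \<alpha> E x else 0) \<partial>lebesgue)"
proof -
  have "meeting_cubes E (half_open_cube a l) \<subseteq> dyadic_cubes (half_open_cube a l)"
    by (auto simp: meeting_cubes_def)
  note infsum_cubes_eq_nn_integral[OF assms(1) this, of "\<lambda>_. dist_weight \<alpha> E",
      OF dist_weight_measurable[OF assms(2)], folded weight_measure_def]
  also have "(\<integral>\<^sup>+x\<in>half_open_cube a l. (\<Sum>k. if cell a l k (idx a l k x) \<in> meeting_cubes E (half_open_cube a l)
        then dist_weight \<alpha> E x else 0) \<partial>lebesgue) =
      (\<integral>\<^sup>+x\<in>half_open_cube a l. (\<Sum>k. if hits E a l k x then dist_weight \<alpha> E x else 0) \<partial>lebesgue)"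
    by (intro nn_integral_cong) (auto simp: indicator_def cell_mem_meeting_cubes_iff[OF assms(1)])
  finally show ?thesis .
qed

text \<open>The block of the base cube and its neighbours, described by addresses so that it is
  visibly a union of cells of every level. Integrals over it can then be compared cell by cell, and
  all these cells belong to the lattice if the base cube does.\<close>

definition triple :: "real ^ 'd::finite \<Rightarrow> real \<Rightarrow> (real ^ 'd) set" where
  "triple a l = {y. \<forall>i. \<bar>idx a l 0 y $ i\<bar> \<le> 1}"

lemma triple_eq_half_open_cube:
  assumes "0 < l"
  shows "triple a l = half_open_cube (\<chi> i. a $ i - l) (3 * l)"
proof -
  have "\<bar>idx a l 0 y $ i\<bar> \<le> 1 \<longleftrightarrow> a $ i - l \<le> y $ i \<and> y $ i < a $ i + 2 * l" for y i
  proof -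
    have "\<bar>idx a l 0 y $ i\<bar> \<le> 1 \<longleftrightarrow> - 1 \<le> \<lfloor>(y $ i - a $ i) / l\<rfloor> \<and> \<lfloor>(y $ i - a $ i) / l\<rfloor> < 2"
      by (simp only: idx_def vec_lambda_beta power_0 mult_1_right) linarith
    also have "\<dots> \<longleftrightarrow> - 1 \<le> (y $ i - a $ i) / l \<and> (y $ i - a $ i) / l < 2"
      by (simp add: le_floor_iff floor_less_iff)
    also have "\<dots> \<longleftrightarrow> a $ i - l \<le> y $ i \<and> y $ i < a $ i + 2 * l"
      using assms by (auto simp: pos_le_divide_eq pos_divide_less_eq)
    finally show ?thesis .
  qed
  then show ?thesis by (simp add: triple_def half_open_cube_def add.commute)
qed

lemma triple_lebesgue: "0 < l \<Longrightarrow> triple a l \<in> sets lebesgue"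
  by (simp add: triple_eq_half_open_cube)

lemma nn_integral_triple_mono:
  assumes "0 < l" and f: "f \<in> borel_measurable lebesgue" and g: "g \<in> borel_measurable lebesgue"
    and le: "\<And>m. cell a l n m \<subseteq> triple a l \<Longrightarrow>
      (\<integral>\<^sup>+x\<in>cell a l n m. f x \<partial>lebesgue) \<le> (\<integral>\<^sup>+x\<in>cell a l n m. g x \<partial>lebesgue)"
  shows "(\<integral>\<^sup>+x\<in>triple a l. f x \<partial>lebesgue) \<le> (\<integral>\<^sup>+x\<in>triple a l. g x \<partial>lebesgue)"
proof -
  have stable: "x \<in> triple a l" if "idx a l n x = idx a l n y" "y \<in> triple a l" for x y
    using idx_mono[OF assms(1), of a 0 n x y] that by (simp add: triple_def)
  then have sub: "cell a l n m \<subseteq> triple a l" if "m \<in> idx a l n ` triple a l" for m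
    using that by (auto simp: cell_def)
  have "triple a l = {y. idx a l n y \<in> idx a l n ` triple a l}"
    using stable by blast
  then show ?thesis
    using nn_integral_cells_mono[OF assms(1) f g, of "idx a l n ` triple a l" a n] le sub by simp
qed

lemma finite_unit_int_vectors: "finite {v :: int ^ 'd::finite. \<forall>i. \<bar>v $ i\<bar> \<le> 1}"
proof -
  have "{v :: int ^ 'd. \<forall>i. \<bar>v $ i\<bar> \<le> 1} \<subseteq> vec_lambda ` (UNIV \<rightarrow>\<^sub>E {-1..1})"
  proof
    fix v :: "int ^ 'd" assume "v \<in> {v. \<forall>i. \<bar>v $ i\<bar> \<le> 1}"
    then have "($) v \<in> UNIV \<rightarrow>\<^sub>E {-1..1}"
      by (auto simp: abs_le_iff)
    then show "v \<in> vec_lambda ` (UNIV \<rightarrow>\<^sub>E {-1..1})"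
      by (intro image_eqI[of _ _ "($) v"]) simp_all
  qed
  then show ?thesis
    by (rule finite_subset) (intro finite_imageI finite_PiE; simp)
qed

text \<open>A point at distance less than \<open>l / 2 ^ k\<close> from \<open>E\<close> lies in a grid cube adjacent to one that
  meets \<open>E\<close>, hence in a translate of the union of the latter.\<close>

lemma emeasure_near_le:
  fixes E :: "(real ^ 'd::finite) set"
  assumes l: "0 < l" and "E \<noteq> {}"
  shows "emeasure lebesgue {x \<in> half_open_cube a l. max_dist x E < l / 2 ^ k} \<le>
    of_nat (card {v :: int ^ 'd. \<forall>i. \<bar>v $ i\<bar> \<le> 1}) * emeasure lebesgue {y \<in> triple a l. hits E a l k y}"
proof -
  define V where "V = {v :: int ^ 'd. \<forall>i. \<bar>v $ i\<bar> \<le> 1}"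
  define H where "H = {y \<in> triple a l. hits E a l k y}"
  define shift :: "int ^ 'd \<Rightarrow> real ^ 'd" where "shift v = (\<chi> i. of_int (v $ i) * (l / 2 ^ k))" for v
  have H: "H \<in> sets lebesgue"
    unfolding H_def using sets.Int[OF triple_lebesgue[OF l] hits_lebesgue[OF l]] by (simp add: Int_def)
  have sub: "{x \<in> half_open_cube a l. max_dist x E < l / 2 ^ k} \<subseteq> (\<Union>v\<in>V. (+) (- shift v) ` H)"
  proof safe
    fix x assume x: "x \<in> half_open_cube a l" "max_dist x E < l / 2 ^ k"
    obtain z where z: "z \<in> E" "infnorm (x - z) < l / 2 ^ k"
      using x(2) max_dist_less_iff[OF assms(2)] by blast
    define v where "v = idx a l k z - idx a l k x"
    have v: "\<bar>v $ i\<bar> \<le> 1" for i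
    proof -
      have "\<bar>x $ i - z $ i\<bar> < l / 2 ^ k"
        using component_le_infnorm_cart[of "x - z" i] z(2) by simp
      then have "\<bar>x $ i - z $ i\<bar> * 2 ^ k / l < 1"
        using l by (simp add: field_simps)
      then have "\<bar>(x $ i - a $ i) * 2 ^ k / l - (z $ i - a $ i) * 2 ^ k / l\<bar> < 1"
        using l by (simp add: abs_mult abs_divide flip: diff_divide_distrib left_diff_distrib)
      then show ?thesis
        unfolding v_def idx_def by (simp add: abs_le_iff) linarith
    qed
    \<comment> \<open>A translation by whole grid steps changes the address by exactly
      \<open>v\<close>, so \<open>y\<close> lands in the cube of \<open>z\<close>. As
      \<open>v\<close> ranges over a finite set independent of \<open>x\<close>, finitely many
      translates cover all near points.\<close>
    define y where "y = x + shift v"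
    have "idx a l k y = idx a l k z"
    proof -
      have "(y $ i - a $ i) * 2 ^ k / l = (x $ i - a $ i) * 2 ^ k / l + of_int (v $ i)" for i
        using l by (simp add: y_def shift_def field_simps)
      then have "idx a l k y = idx a l k x + v"
        by (simp add: idx_def vec_eq_iff)
      then show ?thesis by (simp add: v_def)
    qed
    then have "hits E a l k y"
      using z(1) unfolding hits_def by metis
    moreover have "y \<in> triple a l"
    proof -
      have "\<bar>shift v $ i\<bar> \<le> l" for i
      proof -
        have "\<bar>shift v $ i\<bar> = \<bar>of_int (v $ i)\<bar> * (l / 2 ^ k)"
          using l by (simp add: shift_def abs_mult)
        also have "\<dots> \<le> 1 * (l / 1)"
          using v[of i] l by (intro mult_mono divide_left_mono) (auto simp flip: of_int_abs)
        finally show ?thesis by simp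
      qed
      then have "a $ i - l \<le> y $ i \<and> y $ i < a $ i + 2 * l" for i
        using x(1) \<open>\<And>i. \<bar>shift v $ i\<bar> \<le> l\<close>[of i]
        unfolding half_open_cube_def y_def by (simp add: abs_le_iff) (smt (verit))
      then show ?thesis
        unfolding triple_eq_half_open_cube[OF l] by (simp add: half_open_cube_def add.commute)
    qed
    ultimately have "y \<in> H" by (simp add: H_def)
    moreover have "x = - shift v + y" by (simp add: y_def)
    ultimately show "x \<in> (\<Union>v\<in>V. (+) (- shift v) ` H)"
      using v unfolding V_def by blast
  qed
  have transl: "emeasure lebesgue ((+) b ` H) = emeasure lebesgue H" for b
    using emeasure_lebesgue_affine[of 1 b H] by (simp add: add.commute[of b])
  have meas: "(+) b ` H \<in> sets lebesgue" for b
    by (rule lebesgue_sets_translation[OF H])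
  have "finite V" unfolding V_def by (rule finite_unit_int_vectors)
  have "emeasure lebesgue {x \<in> half_open_cube a l. max_dist x E < l / 2 ^ k} \<le>
      emeasure lebesgue (\<Union>v\<in>V. (+) (- shift v) ` H)"
    by (rule emeasure_mono[OF sub sets.finite_UN[OF \<open>finite V\<close> meas]])
  also have "\<dots> \<le> (\<Sum>v\<in>V. emeasure lebesgue ((+) (- shift v) ` H))"
    by (intro emeasure_subadditive_finite \<open>finite V\<close> image_subsetI meas)
  also have "\<dots> = of_nat (card V) * emeasure lebesgue H"
    by (simp only: transl sum_constant)
  finally show ?thesis unfolding V_def H_def .
qed

lemma AE_notin_closure:
  fixes E :: "(real ^ 'd::finite) set"
  assumes "emeasure lebesgue (closure E) = 0"
  shows "AE x in lebesgue. x \<notin> closure E"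
proof (rule AE_not_in)
  have "closure E \<in> sets lebesgue"
    by (intro sets_completionI_sets) simp
  then show "closure E \<in> null_sets lebesgue"
    using assms by (auto simp: null_sets_def)
qed

text \<open>Points at distance at least \<open>l / 2 ^ n\<close> from \<open>E\<close> are paid for
  by the first term. For the finer levels, the points near \<open>E\<close> are covered by
  translates of the cubes that are hit; these may lie in neighbours of the base cube, which brings
  in the triple. In \<open>c\<close>, the power comes from the gap between consecutive levels and
  the cardinality from the number of translates.\<close>

lemma weight_measure_le_sum_hits:
  fixes E :: "(real ^ 'd::finite) set"
  assumes l: "0 < l" and \<alpha>: "0 < \<alpha>" and E: "E \<noteq> {}" "emeasure lebesgue (closure E) = 0"
  defines "c \<equiv> 2 powr \<alpha> * real (card {v :: int ^ 'd. \<forall>i. \<bar>v $ i\<bar> \<le> 1})"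
  shows "weight_measure \<alpha> E (half_open_cube a l) \<le> rate \<alpha> l n * emeasure lebesgue (half_open_cube a l) +
    ennreal c * (\<integral>\<^sup>+y\<in>triple a l. (\<Sum>k. if hits E a l (n + k) y then rate \<alpha> l (n + k) else 0) \<partial>lebesgue)"
proof -
  let ?R = "half_open_cube a l"
  define N where "N k = {x \<in> ?R. max_dist x E < l / 2 ^ k}" for k
  define H where "H k = {y \<in> triple a l. hits E a l k y}" for k
  define v where "v = card {v :: int ^ 'd. \<forall>i. \<bar>v $ i\<bar> \<le> 1}"
  note [measurable] = max_dist_measurable[OF E(1)]
  have N: "N k \<in> sets lebesgue" for k
  proof -
    have "{x \<in> space lebesgue. max_dist x E < l / 2 ^ k} \<in> sets lebesgue" by measurable
    from sets.Int[OF half_open_cube_lebesgue[of a l] this] show ?thesis by (simp add: N_def Int_def)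
  qed
  have H: "H k \<in> sets lebesgue" for k
    unfolding H_def using sets.Int[OF triple_lebesgue[OF l] hits_lebesgue[OF l]] by (simp add: Int_def)
  have "weight_measure \<alpha> E ?R \<le> (\<integral>\<^sup>+x. rate \<alpha> l n * indicator ?R x + ennreal (2 powr \<alpha>) *
      (\<Sum>k. rate \<alpha> l (n + k) * indicator (N (n + k)) x) \<partial>lebesgue)"
    unfolding weight_measure_def
  proof (intro nn_integral_mono_AE)
    show "AE x in lebesgue. dist_weight \<alpha> E x * indicator ?R x \<le> rate \<alpha> l n * indicator ?R x +
      ennreal (2 powr \<alpha>) * (\<Sum>k. rate \<alpha> l (n + k) * indicator (N (n + k)) x)"
      using AE_notin_closure[OF E(2)]
    proof eventually_elim
      case (elim x)
      show ?case
      proof (cases "x \<in> ?R")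
        case True
        then have "(\<Sum>k. rate \<alpha> l (n + k) * indicator (N (n + k)) x) =
            (\<Sum>k. if max_dist x E < l / 2 ^ (n + k) then rate \<alpha> l (n + k) else 0)"
          by (intro suminf_cong) (simp add: N_def)
        then show ?thesis
          using dist_weight_le_sum_near[OF E(1) l \<alpha> elim, of n] True by simp
      qed simp
    qed
  qed
  also have "\<dots> = rate \<alpha> l n * emeasure lebesgue ?R + ennreal (2 powr \<alpha>) *
      (\<Sum>k. rate \<alpha> l (n + k) * emeasure lebesgue (N (n + k)))"
    using N by (subst nn_integral_add)
      (simp_all add: nn_integral_cmult nn_integral_suminf nn_integral_cmult_indicator del: emeasure_completion)
  also have "\<dots> \<le> rate \<alpha> l n * emeasure lebesgue ?R + ennreal (2 powr \<alpha>) *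
      (\<Sum>k. of_nat v * (rate \<alpha> l (n + k) * emeasure lebesgue (H (n + k))))"
  proof (intro add_left_mono mult_left_mono suminf_le)
    fix k
    have "rate \<alpha> l (n + k) * emeasure lebesgue (N (n + k)) \<le>
        rate \<alpha> l (n + k) * (of_nat v * emeasure lebesgue (H (n + k)))"
      unfolding N_def H_def v_def by (intro mult_left_mono emeasure_near_le[OF l E(1)]) simp
    then show "rate \<alpha> l (n + k) * emeasure lebesgue (N (n + k)) \<le>
        of_nat v * (rate \<alpha> l (n + k) * emeasure lebesgue (H (n + k)))"
      by (simp only: mult.left_commute)
  qed auto
  also have "\<dots> = rate \<alpha> l n * emeasure lebesgue ?R + ennreal c *
      (\<Sum>k. rate \<alpha> l (n + k) * emeasure lebesgue (H (n + k)))"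
    unfolding c_def v_def[symmetric]
    by (simp add: ennreal_suminf_cmult ennreal_mult mult.assoc ennreal_of_nat_eq_real_of_nat del: emeasure_completion)
  also have "(\<Sum>k. rate \<alpha> l (n + k) * emeasure lebesgue (H (n + k))) =
      (\<integral>\<^sup>+y. (\<Sum>k. rate \<alpha> l (n + k) * indicator (H (n + k)) y) \<partial>lebesgue)"
    using H by (subst nn_integral_suminf) (simp_all add: nn_integral_cmult_indicator del: emeasure_completion)
  also have "\<dots> = (\<integral>\<^sup>+y\<in>triple a l. (\<Sum>k. if hits E a l (n + k) y then rate \<alpha> l (n + k) else 0) \<partial>lebesgue)"
  proof (intro nn_integral_cong)
    fix y
    show "(\<Sum>k. rate \<alpha> l (n + k) * indicator (H (n + k)) y) =
       (\<Sum>k. if hits E a l (n + k) y then rate \<alpha> l (n + k) else 0) * indicator (triple a l) y"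
      by (cases "y \<in> triple a l") (auto simp: H_def indicator_def intro!: suminf_cong)
  qed
  finally show ?thesis .
qed

section \<open>Equivalence of the conditions\<close>

lemma emeasure_triple:
  fixes a :: "real ^ 'd::finite"
  assumes "0 < l"
  shows "emeasure lebesgue (triple a l) = ennreal (3 ^ CARD('d)) * emeasure lebesgue (half_open_cube a l)"
proof -
  have "emeasure lebesgue (triple a l) = ennreal ((3 * l) ^ CARD('d))"
    unfolding triple_eq_half_open_cube[OF assms] using assms by (intro emeasure_half_open_cube) simp
  also have "\<dots> = ennreal (3 ^ CARD('d)) * ennreal (l ^ CARD('d))"
    unfolding power_mult_distrib using assms by (intro ennreal_mult) simp_all
  also have "ennreal (l ^ CARD('d)) = emeasure lebesgue (half_open_cube a l)"
    using assms by (intro emeasure_half_open_cube[symmetric]) simp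
  finally show ?thesis .
qed

lemma lattice_cubeE:
  assumes "dyadic_lattice D" "R \<in> D"
  obtains a l where "0 < l" "R = half_open_cube a l"
proof -
  have "is_cube R" using assms by (simp add: dyadic_lattice_def)
  then show thesis unfolding is_cube_def using that by blast
qed

lemma scaled_volume_le_weight_measure:
  fixes E :: "(real ^ 'd::finite) set"
  assumes "0 < l" "0 < \<alpha>" "half_open_cube a l \<inter> E \<noteq> {}"
  shows "scaled_volume \<alpha> (half_open_cube a l) \<le> weight_measure \<alpha> E (half_open_cube a l)"
proof -
  have E: "E \<noteq> {}" using assms(3) by blast
  have "hits E a l 0 x" if "x \<in> half_open_cube a l" for x
    using assms(3) that unfolding hits_def half_open_cube_eq_cell[OF assms(1)] cell_def by auto
  then have le: "rate \<alpha> l 0 \<le> dist_weight \<alpha> E x" if "x \<in> half_open_cube a l" for x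
    using rate_le_dist_weight_if_hits[OF E assms(2,1)] that by blast
  have "scaled_volume \<alpha> (half_open_cube a l) = (\<integral>\<^sup>+x\<in>half_open_cube a l. rate \<alpha> l 0 \<partial>lebesgue)"
    by (simp add: scaled_volume_half_open_cube[OF assms(1)] nn_integral_cmult_indicator del: emeasure_completion)
  also have "\<dots> \<le> weight_measure \<alpha> E (half_open_cube a l)"
    unfolding weight_measure_def using le by (intro nn_integral_mono) (auto simp: indicator_def)
  finally show ?thesis .
qed

text \<open>The hypothesis is applied to each level-0 cube of the triple, all of which lie in the
  lattice and have the scaled volume of \<open>R\<close>; this yields the factor
  \<open>3 ^ CARD('d)\<close>. The summand 1 is the first term of the preceding estimate with
  \<open>n = 0\<close>.\<close>

lemma weight_bound_if_meeting_volume_bound: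
  fixes D :: "(real ^ 'd::finite) set set"
  assumes D: "dyadic_lattice D" and E: "E \<noteq> {}" "emeasure lebesgue (closure E) = 0"
    and "0 < \<alpha>" "0 < \<zeta>"
    and Z: "\<forall>R\<in>D. (\<Sum>\<^sub>\<infinity>Q\<in>meeting_cubes E R. scaled_volume \<alpha> Q) \<le> ennreal \<zeta> * scaled_volume \<alpha> R"
  shows "\<exists>C>0. \<forall>R\<in>D. weight_measure \<alpha> E R \<le> ennreal C * scaled_volume \<alpha> R"
proof -
  define c where "c = 2 powr \<alpha> * real (card {v :: int ^ 'd. \<forall>i. \<bar>v $ i\<bar> \<le> 1})"
  have "0 \<le> c" by (simp add: c_def)
  have "weight_measure \<alpha> E R \<le> ennreal (1 + c * \<zeta> * 3 ^ CARD('d)) * scaled_volume \<alpha> R" if "R \<in> D" for R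
  proof -
    obtain a l where l: "0 < l" and R: "R = half_open_cube a l"
      by (rule lattice_cubeE[OF D \<open>R \<in> D\<close>])
    let ?s = "\<lambda>y. \<Sum>k. if hits E a l k y then rate \<alpha> l k else 0"
    have "(\<integral>\<^sup>+y\<in>triple a l. ?s y \<partial>lebesgue) \<le> (\<integral>\<^sup>+y\<in>triple a l. ennreal \<zeta> * rate \<alpha> l 0 \<partial>lebesgue)"
    proof (rule nn_integral_triple_mono[OF l, where n = 0])
      show "?s \<in> borel_measurable lebesgue"
        using measurable_sum_hits[OF l, of "\<lambda>k _. rate \<alpha> l k" E a 0] by simp
      fix m
      define b where "b = corner a l 0 m"
      have b: "cell a l 0 m = half_open_cube b l"
        using cell_eq_half_open_cube[OF l, of a 0 m] by (simp add: b_def)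
      have "half_open_cube b l \<in> D"
        using lattice_cell[OF D l] that unfolding R by (simp flip: b)
      then have "(\<integral>\<^sup>+x\<in>half_open_cube b l. (\<Sum>k. if hits E b l k x then rate \<alpha> l k else 0) \<partial>lebesgue)
          \<le> ennreal \<zeta> * scaled_volume \<alpha> (half_open_cube b l)"
        using bspec[OF Z, of "half_open_cube b l"] unfolding sum_meeting_volume[OF l] by blast
      also have "\<dots> = (\<integral>\<^sup>+x\<in>half_open_cube b l. ennreal \<zeta> * rate \<alpha> l 0 \<partial>lebesgue)"
        unfolding scaled_volume_half_open_cube[OF l]
        by (simp add: nn_integral_cmult_indicator del: emeasure_completion flip: mult.assoc)
      finally show "(\<integral>\<^sup>+y\<in>cell a l 0 m. ?s y \<partial>lebesgue) \<le> (\<integral>\<^sup>+y\<in>cell a l 0 m. ennreal \<zeta> * rate \<alpha> l 0 \<partial>lebesgue)"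
        using hits_corner[OF l, of E a 0 m] by (simp add: b flip: b_def)
    qed simp
    also have "\<dots> = ennreal \<zeta> * rate \<alpha> l 0 * (ennreal (3 ^ CARD('d)) * emeasure lebesgue R)"
      by (simp add: nn_integral_cmult_indicator triple_lebesgue[OF l] emeasure_triple[OF l] R del: emeasure_completion)
    also have "\<dots> = ennreal (\<zeta> * 3 ^ CARD('d)) * scaled_volume \<alpha> R"
      using \<open>0 < \<zeta>\<close> unfolding R scaled_volume_half_open_cube[OF l] by (simp add: ennreal_mult mult_ac)
    finally have I: "(\<integral>\<^sup>+y\<in>triple a l. ?s y \<partial>lebesgue) \<le> ennreal (\<zeta> * 3 ^ CARD('d)) * scaled_volume \<alpha> R" .
    have "weight_measure \<alpha> E R \<le> scaled_volume \<alpha> R + ennreal c * (\<integral>\<^sup>+y\<in>triple a l. ?s y \<partial>lebesgue)"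
      using weight_measure_le_sum_hits[OF l \<open>0 < \<alpha>\<close> E, of a 0]
      unfolding R scaled_volume_half_open_cube[OF l] c_def[symmetric] add_0 .
    also have "\<dots> \<le> scaled_volume \<alpha> R + ennreal c * (ennreal (\<zeta> * 3 ^ CARD('d)) * scaled_volume \<alpha> R)"
      by (intro add_left_mono mult_left_mono I) simp
    also have "\<dots> = ennreal (1 + c * \<zeta> * 3 ^ CARD('d)) * scaled_volume \<alpha> R"
      using \<open>0 \<le> c\<close> \<open>0 < \<zeta>\<close> by (simp add: distrib_right ennreal_mult mult.assoc)
    finally show ?thesis .
  qed
  moreover have "0 < 1 + c * \<zeta> * 3 ^ CARD('d)"
    using \<open>0 \<le> c\<close> \<open>0 < \<zeta>\<close> by (simp add: add_pos_nonneg)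
  ultimately show ?thesis by blast
qed

lemma meeting_volume_bound_if_weight_bound:
  fixes D :: "(real ^ 'd::finite) set set"
  assumes D: "dyadic_lattice D" and E: "E \<noteq> {}" "emeasure lebesgue (closure E) = 0"
    and "0 < \<alpha>" "0 < C"
    and M: "\<forall>R\<in>D. weight_measure \<alpha> E R \<le> ennreal C * scaled_volume \<alpha> R"
  shows "\<exists>\<zeta>>0. \<forall>R\<in>D. (\<Sum>\<^sub>\<infinity>Q\<in>meeting_cubes E R. scaled_volume \<alpha> Q) \<le> ennreal \<zeta> * scaled_volume \<alpha> R"
proof -
  have q: "1 < 2 powr \<alpha>" using assms(4) powr_less_mono[of 0 \<alpha> 2] by simp
  define c where "c = 2 powr \<alpha> / (2 powr \<alpha> - 1)"
  have "0 < c" using q by (simp add: c_def)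
  have "(\<Sum>\<^sub>\<infinity>Q\<in>meeting_cubes E R. scaled_volume \<alpha> Q) \<le> ennreal (c * C) * scaled_volume \<alpha> R" if "R \<in> D" for R
  proof -
    obtain a l where l: "0 < l" and R: "R = half_open_cube a l"
      by (rule lattice_cubeE[OF D \<open>R \<in> D\<close>])
    have "(\<Sum>\<^sub>\<infinity>Q\<in>meeting_cubes E R. scaled_volume \<alpha> Q) \<le> (\<integral>\<^sup>+x. ennreal c * (dist_weight \<alpha> E x * indicator R x) \<partial>lebesgue)"
      unfolding R sum_meeting_volume[OF l]
    proof (rule nn_integral_mono_AE)
      show "AE x in lebesgue. (\<Sum>k. if hits E a l k x then rate \<alpha> l k else 0) * indicator (half_open_cube a l) x
        \<le> ennreal c * (dist_weight \<alpha> E x * indicator (half_open_cube a l) x)"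
        using AE_notin_closure[OF E(2)]
      proof eventually_elim
        case (elim x)
        then show ?case
          using sum_hits_le_dist_weight[OF E(1) l assms(4), of x a]
          by (cases "x \<in> half_open_cube a l") (simp_all add: c_def)
      qed
    qed
    also have "\<dots> = ennreal c * weight_measure \<alpha> E R"
      unfolding weight_measure_def using dist_weight_measurable[OF E(1), of \<alpha>]
      by (intro nn_integral_cmult) (simp add: R)
    also have "\<dots> \<le> ennreal c * (ennreal C * scaled_volume \<alpha> R)"
      using M that by (intro mult_left_mono) auto
    finally show ?thesis
      using \<open>0 < c\<close> \<open>0 < C\<close> by (simp add: ennreal_mult mult.assoc)
  qed
  then show ?thesis
    using \<open>0 < c\<close> \<open>0 < C\<close> by (intro exI[of _ "c * C"]) simp
qed

section \<open>Maximal free cubes against meeting cubes\<close>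

lemma meeting_cubes_lattice:
  fixes D :: "(real ^ 'd::finite) set set"
  assumes D: "dyadic_lattice D"
  shows "(\<Union>S\<in>D. meeting_cubes E S) = {R \<in> D. R \<inter> E \<noteq> {}}"
proof -
  have self: "half_open_cube a l \<in> dyadic_cubes (half_open_cube a l)" if "0 < l" for a :: "real ^ 'd" and l
    using that unfolding dyadic_cubes_def dyadic_generation_half_open_cube[OF that]
    by (intro UN_I[of 0] CollectI exI[of _ 0]) (simp_all add: half_open_cube_eq_cell)
  show ?thesis
  proof (intro equalityI subsetI)
    fix R assume "R \<in> (\<Union>S\<in>D. meeting_cubes E S)"
    then obtain S where "S \<in> D" "R \<in> dyadic_cubes S" "R \<inter> E \<noteq> {}"
      by (auto simp: meeting_cubes_def)
    then show "R \<in> {R \<in> D. R \<inter> E \<noteq> {}}"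
      using D by (auto simp: dyadic_lattice_def)
  next
    fix R assume "R \<in> {R \<in> D. R \<inter> E \<noteq> {}}"
    then have R: "R \<in> D" "R \<inter> E \<noteq> {}" by auto
    obtain a l where "0 < l" "R = half_open_cube a l"
      by (rule lattice_cubeE[OF D R(1)])
    then have "R \<in> meeting_cubes E R"
      using R(2) self by (simp add: meeting_cubes_def)
    then show "R \<in> (\<Union>S\<in>D. meeting_cubes E S)"
      using R(1) by blast
  qed
qed

lemma free_volume_bound_if_meeting_volume_bound:
  fixes D :: "(real ^ 'd::finite) set set"
  assumes D: "dyadic_lattice D" and "0 < \<zeta>"
    and Z: "\<forall>R\<in>D. (\<Sum>\<^sub>\<infinity>Q\<in>meeting_cubes E R. scaled_volume \<alpha> Q) \<le> ennreal \<zeta> * scaled_volume \<alpha> R"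
  shows "\<exists>C>0. \<forall>R\<in>(\<Union>S\<in>D. meeting_cubes E S).
    (\<Sum>\<^sub>\<infinity>Q\<in>maximal_free_cubes D E R. scaled_volume \<alpha> Q) \<le> ennreal C * scaled_volume \<alpha> R"
proof -
  have "(\<Sum>\<^sub>\<infinity>Q\<in>maximal_free_cubes D E R. scaled_volume \<alpha> Q) \<le> ennreal (2 powr \<alpha> * \<zeta>) * scaled_volume \<alpha> R"
    if "R \<in> D" for R
  proof -
    obtain a l where l: "0 < l" and R: "R = half_open_cube a l"
      by (rule lattice_cubeE[OF D \<open>R \<in> D\<close>])
    have "(\<Sum>\<^sub>\<infinity>Q\<in>maximal_free_cubes D E R. scaled_volume \<alpha> Q) \<le>
        (\<integral>\<^sup>+x. ennreal (2 powr \<alpha>) * ((\<Sum>k. if hits E a l k x then rate \<alpha> l k else 0) * indicator R x) \<partial>lebesgue)"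
      unfolding sum_maximal_free_volume[OF D l that[unfolded R], folded R]
      using first_missed_le_sum_hits[OF l, of E a _ \<alpha>]
      by (intro nn_integral_mono) (auto simp: indicator_def)
    also have "\<dots> = ennreal (2 powr \<alpha>) * (\<Sum>\<^sub>\<infinity>Q\<in>meeting_cubes E R. scaled_volume \<alpha> Q)"
      unfolding R sum_meeting_volume[OF l] using measurable_sum_hits[OF l, of "\<lambda>k _. rate \<alpha> l k" E a 0]
      by (intro nn_integral_cmult borel_measurable_times_ennreal borel_measurable_indicator) simp_all
    also have "\<dots> \<le> ennreal (2 powr \<alpha>) * (ennreal \<zeta> * scaled_volume \<alpha> R)"
      using Z that by (intro mult_left_mono) auto
    finally show ?thesis
      using \<open>0 < \<zeta>\<close> by (simp add: ennreal_mult mult.assoc)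
  qed
  then show ?thesis
    unfolding meeting_cubes_lattice[OF D] using \<open>0 < \<zeta>\<close> by (intro exI[of _ "2 powr \<alpha> * \<zeta>"]) simp
qed

lemma meeting_cubes_eq_empty:
  assumes "dyadic_lattice D" "R \<in> D" "R \<inter> E = {}"
  shows "meeting_cubes E R = {}"
proof -
  obtain a l where "0 < l" "R = half_open_cube a l"
    by (rule lattice_cubeE[OF assms(1,2)])
  then have "Q \<subseteq> R" if "Q \<in> dyadic_cubes R" for Q
    using that dyadic_cubes_subset by blast
  then show ?thesis
    using assms(3) unfolding meeting_cubes_def by blast
qed

lemma meeting_volume_bound_if_free_volume_bound:
  fixes D :: "(real ^ 'd::finite) set set"
  assumes D: "dyadic_lattice D" and E: "E \<noteq> {}" "emeasure lebesgue (closure E) = 0"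
    and "0 < \<alpha>" "0 < C"
    and A: "\<forall>R\<in>(\<Union>S\<in>D. meeting_cubes E S).
      (\<Sum>\<^sub>\<infinity>Q\<in>maximal_free_cubes D E R. scaled_volume \<alpha> Q) \<le> ennreal C * scaled_volume \<alpha> R"
  shows "\<exists>\<zeta>>0. \<forall>R\<in>D. (\<Sum>\<^sub>\<infinity>Q\<in>meeting_cubes E R. scaled_volume \<alpha> Q) \<le> ennreal \<zeta> * scaled_volume \<alpha> R"
proof -
  have q: "1 < 2 powr \<alpha>" using assms(4) powr_less_mono[of 0 \<alpha> 2] by simp
  define c where "c = 1 / (2 powr \<alpha> - 1)"
  have "0 < c" using q by (simp add: c_def)
  have "(\<Sum>\<^sub>\<infinity>Q\<in>meeting_cubes E R. scaled_volume \<alpha> Q) \<le> ennreal (c * C) * scaled_volume \<alpha> R"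
    if "R \<in> D" for R
  proof (cases "R \<inter> E = {}")
    \<comment> \<open>The hypothesis is silent about such \<open>R\<close>, but no subcube of
      \<open>R\<close> meets \<open>E\<close> and the sum is empty.\<close>
    case True
    then show ?thesis by (simp add: meeting_cubes_eq_empty[OF D that])
  next
    case False
    obtain a l where l: "0 < l" and R: "R = half_open_cube a l"
      by (rule lattice_cubeE[OF D \<open>R \<in> D\<close>])
    have hits: "hits E a l 0 x" if "x \<in> R" for x
      using False that unfolding hits_def R half_open_cube_eq_cell[OF l] cell_def by auto
    have meas: "(\<lambda>x. \<Sum>k. if 0 < k \<and> \<not> hits E a l k x \<and> hits E a l (k - 1) x then rate \<alpha> l k else 0)
        \<in> borel_measurable lebesgue"
    proof -
      note [measurable] = measurable_hits[OF l]
      show ?thesis by measurable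
    qed
    have "(\<Sum>\<^sub>\<infinity>Q\<in>meeting_cubes E R. scaled_volume \<alpha> Q) \<le> (\<integral>\<^sup>+x. ennreal c *
        ((\<Sum>k. if 0 < k \<and> \<not> hits E a l k x \<and> hits E a l (k - 1) x then rate \<alpha> l k else 0) * indicator R x) \<partial>lebesgue)"
      unfolding sum_meeting_volume[OF l, of \<alpha> E a, folded R]
    proof (rule nn_integral_mono_AE)
      show "AE x in lebesgue. (\<Sum>k. if hits E a l k x then rate \<alpha> l k else 0) * indicator R x \<le> ennreal c *
        ((\<Sum>k. if 0 < k \<and> \<not> hits E a l k x \<and> hits E a l (k - 1) x then rate \<alpha> l k else 0) * indicator R x)"
        using AE_notin_closure[OF E(2)]
      proof eventually_elim
        case (elim x)
        then show ?case
          using sum_hits_le_first_missed[OF E(1) l assms(4), of x a] hits[of x]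
          by (cases "x \<in> R") (simp_all add: c_def)
      qed
    qed
    also have "\<dots> = ennreal c * (\<Sum>\<^sub>\<infinity>Q\<in>maximal_free_cubes D E R. scaled_volume \<alpha> Q)"
      unfolding sum_maximal_free_volume[OF D l that[unfolded R], folded R]
      by (rule nn_integral_cmult[OF borel_measurable_times_ennreal[OF meas borel_measurable_indicator]]) (simp add: R)
    also have "\<dots> \<le> ennreal c * (ennreal C * scaled_volume \<alpha> R)"
      using A that False unfolding meeting_cubes_lattice[OF D] by (intro mult_left_mono) auto
    finally show ?thesis
      using \<open>0 < c\<close> \<open>0 < C\<close> by (simp add: ennreal_mult mult.assoc)
  qed
  then show ?thesis
    using \<open>0 < c\<close> \<open>0 < C\<close> by (intro exI[of _ "c * C"]) simp
qed

text \<open>The hypothesis is used twice: on the subcubes of generation \<open>n\<close> that meet \<open>E\<close>, and on the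
  neighbours of the given cube, where Chebyshev's inequality shows that the points lying in a
  meeting cube of generation \<open>n\<close> carry at most the fraction \<open>\<xi> / (n + 1)\<close> of the weight.\<close>

lemma sum_hits_rate_le_weight:
  fixes D :: "(real ^ 'd::finite) set set"
  assumes D: "dyadic_lattice D" and E: "E \<noteq> {}" and "0 < \<alpha>"
    and X: "\<forall>R\<in>D. (\<Sum>\<^sub>\<infinity>Q\<in>meeting_cubes E R. weight_measure \<alpha> E Q) \<le> ennreal \<xi> * weight_measure \<alpha> E R"
    and l: "0 < l" and R: "half_open_cube a l \<in> D"
  shows "of_nat (Suc n) * (\<integral>\<^sup>+y\<in>triple a l. (\<Sum>k. if hits E a l (n + k) y then rate \<alpha> l (n + k) else 0) \<partial>lebesgue)
    \<le> ennreal \<xi> * (ennreal \<xi> * (\<integral>\<^sup>+y\<in>triple a l. dist_weight \<alpha> E y \<partial>lebesgue))"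
proof -
  let ?w = "dist_weight \<alpha> E"
  let ?h = "\<lambda>y. if hits E a l n y then ?w y else 0"
  let ?t = "\<lambda>y. \<Sum>k. if hits E a l (n + k) y then ?w y else 0"
  have w: "?w \<in> borel_measurable lebesgue"
    by (rule dist_weight_measurable[OF E])
  have h: "?h \<in> borel_measurable lebesgue"
  proof -
    note [measurable] = w measurable_hits[OF l]
    show ?thesis by measurable
  qed
  have t: "?t \<in> borel_measurable lebesgue"
    by (rule measurable_sum_hits[OF l w])
  have tri: "(\<lambda>y. f y * indicator (triple a l) y) \<in> borel_measurable lebesgue"
    if "f \<in> borel_measurable lebesgue" for f :: "_ \<Rightarrow> ennreal"
    by (rule borel_measurable_times_ennreal[OF that borel_measurable_indicator[OF triple_lebesgue[OF l]]])
  have "(\<integral>\<^sup>+y\<in>triple a l. (\<Sum>k. if hits E a l (n + k) y then rate \<alpha> l (n + k) else 0) \<partial>lebesgue)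
      \<le> (\<integral>\<^sup>+y\<in>triple a l. ?t y \<partial>lebesgue)"
    using rate_le_dist_weight_if_hits[OF E \<open>0 < \<alpha>\<close> l]
    by (intro nn_integral_mono mult_right_mono suminf_le) auto
  \<comment> \<open>On each cell of level \<open>n\<close> the sum over the levels
    \<open>n + k\<close> is the full meeting sum of that cell taken as a new base, so the hypothesis
    applies to it.\<close>
  also have "\<dots> \<le> (\<integral>\<^sup>+y\<in>triple a l. ennreal \<xi> * ?h y \<partial>lebesgue)"
  proof (rule nn_integral_triple_mono[OF l t, where n = n])
    show "(\<lambda>y. ennreal \<xi> * ?h y) \<in> borel_measurable lebesgue"
      using h by (rule borel_measurable_times_ennreal[OF borel_measurable_const])
    fix m
    define b where "b = corner a l n m"
    have s: "0 < l / 2 ^ n" using l by simp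
    have b: "cell a l n m = half_open_cube b (l / 2 ^ n)"
      using cell_eq_half_open_cube[OF l, of a n m] by (simp add: b_def)
    have bD: "half_open_cube b (l / 2 ^ n) \<in> D"
      using lattice_cell[OF D l R, of n m] by (simp add: b)
    show "(\<integral>\<^sup>+y\<in>cell a l n m. ?t y \<partial>lebesgue) \<le> (\<integral>\<^sup>+y\<in>cell a l n m. ennreal \<xi> * ?h y \<partial>lebesgue)"
    proof (cases "cell a l n m \<inter> E = {}")
      \<comment> \<open>The right-hand side vanishes here, so a bound by the whole weight of the
        cell would not help; but the subcubes of a cell missing \<open>E\<close> miss it
        too.\<close>
      case True
      then have "\<not> hits E a l n y" if "y \<in> cell a l n m" for y
        using that unfolding hits_def cell_def by auto
      then have "\<not> hits E a l (n + k) y" if "y \<in> cell a l n m" for y k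
        using that hits_antimono[OF l, of E a "n + k" y n] by auto
      then have "(\<integral>\<^sup>+y\<in>cell a l n m. ?t y \<partial>lebesgue) = (\<integral>\<^sup>+y. 0 \<partial>(lebesgue :: (real ^ 'd) measure))"
        by (intro nn_integral_cong) (auto simp: indicator_def)
      then show ?thesis by simp
    next
      case False
      then have hit: "hits E a l n y" if "y \<in> cell a l n m" for y
        using that unfolding hits_def cell_def by auto
      have "(\<integral>\<^sup>+y\<in>cell a l n m. ?t y \<partial>lebesgue) =
          (\<integral>\<^sup>+x\<in>half_open_cube b (l / 2 ^ n). (\<Sum>k. if hits E b (l / 2 ^ n) k x then ?w x else 0) \<partial>lebesgue)"
        unfolding b b_def hits_corner[OF l] ..
      also have "\<dots> \<le> ennreal \<xi> * weight_measure \<alpha> E (half_open_cube b (l / 2 ^ n))"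
        using bspec[OF X bD] unfolding sum_meeting_weight[OF s E] .
      also have "\<dots> = (\<integral>\<^sup>+y. ennreal \<xi> * (?w y * indicator (half_open_cube b (l / 2 ^ n)) y) \<partial>lebesgue)"
        unfolding weight_measure_def
        by (rule nn_integral_cmult[symmetric, OF borel_measurable_times_ennreal[OF w borel_measurable_indicator]]) simp
      also have "\<dots> = (\<integral>\<^sup>+y\<in>cell a l n m. ennreal \<xi> * ?h y \<partial>lebesgue)"
        unfolding b[symmetric] using hit by (intro nn_integral_cong) (auto simp: indicator_def)
      finally show ?thesis .
    qed
  qed
  also have "\<dots> = ennreal \<xi> * (\<integral>\<^sup>+y\<in>triple a l. ?h y \<partial>lebesgue)"
    unfolding mult.assoc by (rule nn_integral_cmult[OF tri[OF h]])
  finally have 1: "of_nat (Suc n) * (\<integral>\<^sup>+y\<in>triple a l. (\<Sum>k. if hits E a l (n + k) y then rate \<alpha> l (n + k) else 0) \<partial>lebesgue)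
      \<le> ennreal \<xi> * (of_nat (Suc n) * (\<integral>\<^sup>+y\<in>triple a l. ?h y \<partial>lebesgue))"
    unfolding mult.left_commute[of "ennreal \<xi>"] by (rule mult_left_mono) simp
  have "of_nat (Suc n) * (\<integral>\<^sup>+y\<in>triple a l. ?h y \<partial>lebesgue) = (\<integral>\<^sup>+y\<in>triple a l. of_nat (Suc n) * ?h y \<partial>lebesgue)"
    unfolding mult.assoc by (rule nn_integral_cmult[symmetric, OF tri[OF h]])
  also have "\<dots> \<le> (\<integral>\<^sup>+y\<in>triple a l. ennreal \<xi> * ?w y \<partial>lebesgue)"
  proof (rule nn_integral_triple_mono[OF l, where n = 0])
    show "(\<lambda>y. of_nat (Suc n) * ?h y) \<in> borel_measurable lebesgue"
      using h by (rule borel_measurable_times_ennreal[OF borel_measurable_const])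
    show "(\<lambda>y. ennreal \<xi> * ?w y) \<in> borel_measurable lebesgue"
      using w by (rule borel_measurable_times_ennreal[OF borel_measurable_const])
    fix m
    define b where "b = corner a l 0 m"
    have b: "cell a l 0 m = half_open_cube b l"
      using cell_eq_half_open_cube[OF l, of a 0 m] by (simp add: b_def)
    have bD: "half_open_cube b l \<in> D"
      using lattice_cell[OF D l R, of 0 m] by (simp add: b)
    have hb: "hits E b l k y = hits E a l k y" for k y
      using hits_corner[OF l, of E a 0 m k y] by (simp add: b_def)
    \<comment> \<open>A hit at level \<open>n\<close> entails hits at all the levels 0 to
      \<open>n\<close>, which makes \<open>n + 1\<close> equal summands.\<close>
    have le: "of_nat (Suc n) * ?h y \<le> (\<Sum>k. if hits E a l k y then ?w y else 0)" for y
    proof (cases "hits E a l n y")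
      case True
      have "of_nat (Suc n) * ?h y = (\<Sum>k\<in>{..n}. if hits E a l k y then ?w y else 0)"
        using True hits_antimono[OF l True] by simp
      also have "\<dots> \<le> (\<Sum>k. if hits E a l k y then ?w y else 0)"
        by (intro sum_le_suminf) auto
      finally show ?thesis .
    qed simp
    have "(\<integral>\<^sup>+y\<in>cell a l 0 m. of_nat (Suc n) * ?h y \<partial>lebesgue) \<le>
        (\<integral>\<^sup>+x\<in>half_open_cube b l. (\<Sum>k. if hits E b l k x then ?w x else 0) \<partial>lebesgue)"
      unfolding b hb using le by (intro nn_integral_mono mult_right_mono) auto
    also have "\<dots> \<le> ennreal \<xi> * weight_measure \<alpha> E (half_open_cube b l)"
      using bspec[OF X bD] unfolding sum_meeting_weight[OF l E] .
    also have "\<dots> = (\<integral>\<^sup>+y\<in>cell a l 0 m. ennreal \<xi> * ?w y \<partial>lebesgue)"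
      unfolding weight_measure_def b mult.assoc
      by (rule nn_integral_cmult[symmetric, OF borel_measurable_times_ennreal[OF w borel_measurable_indicator]]) simp
    finally show "(\<integral>\<^sup>+y\<in>cell a l 0 m. of_nat (Suc n) * ?h y \<partial>lebesgue) \<le>
        (\<integral>\<^sup>+y\<in>cell a l 0 m. ennreal \<xi> * ?w y \<partial>lebesgue)" .
  qed
  also have "\<dots> = ennreal \<xi> * (\<integral>\<^sup>+y\<in>triple a l. ?w y \<partial>lebesgue)"
    unfolding mult.assoc by (rule nn_integral_cmult[OF tri[OF w]])
  finally have "ennreal \<xi> * (of_nat (Suc n) * (\<integral>\<^sup>+y\<in>triple a l. ?h y \<partial>lebesgue))
      \<le> ennreal \<xi> * (ennreal \<xi> * (\<integral>\<^sup>+y\<in>triple a l. ?w y \<partial>lebesgue))"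
    by (rule mult_left_mono) simp
  with 1 show ?thesis by (rule order_trans)
qed

text \<open>The triple consists of \<open>6 ^ CARD('d)\<close> cells of half the side. Instead of
  counting them, \<open>w\<close> is compared with a constant density of integral \<open>W\<close>
  over each cell; the count reappears as the ratio of volumes.\<close>

lemma nn_integral_triple_le_half_cells:
  fixes a :: "real ^ 'd::finite"
  assumes l: "0 < l" and w: "w \<in> borel_measurable lebesgue"
    and le: "\<And>m. cell a l 1 m \<subseteq> triple a l \<Longrightarrow> (\<integral>\<^sup>+y\<in>cell a l 1 m. w y \<partial>lebesgue) \<le> W"
  shows "(\<integral>\<^sup>+y\<in>triple a l. w y \<partial>lebesgue) \<le> ennreal (6 ^ CARD('d)) * W"
proof -
  define q where "q = ennreal (1 / (l / 2) ^ CARD('d))"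
  have "(\<integral>\<^sup>+y\<in>triple a l. w y \<partial>lebesgue) \<le> (\<integral>\<^sup>+y\<in>triple a l. W * q \<partial>lebesgue)"
  proof (rule nn_integral_triple_mono[OF l w, where n = 1])
    fix m assume "cell a l 1 m \<subseteq> triple a l"
    then have "(\<integral>\<^sup>+y\<in>cell a l 1 m. w y \<partial>lebesgue) \<le> W" by (rule le)
    also have "W = W * (q * ennreal ((l / 2) ^ CARD('d)))"
      using l by (simp add: q_def flip: ennreal_mult)
    also have "ennreal ((l / 2) ^ CARD('d)) = emeasure lebesgue (cell a l 1 m)"
      unfolding cell_eq_half_open_cube[OF l] using l by (subst emeasure_half_open_cube) auto
    also have "W * (q * emeasure lebesgue (cell a l 1 m)) = (\<integral>\<^sup>+y\<in>cell a l 1 m. W * q \<partial>lebesgue)"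
      unfolding mult.assoc[symmetric] nn_integral_cmult_indicator[OF cell_lebesgue[OF l]] ..
    finally show "(\<integral>\<^sup>+y\<in>cell a l 1 m. w y \<partial>lebesgue) \<le> (\<integral>\<^sup>+y\<in>cell a l 1 m. W * q \<partial>lebesgue)" .
  qed simp
  also have "\<dots> = W * q * ennreal ((3 * l) ^ CARD('d))"
    unfolding nn_integral_cmult_indicator[OF triple_lebesgue[OF l]]
    unfolding triple_eq_half_open_cube[OF l] using l by (subst emeasure_half_open_cube) auto
  also have "\<dots> = W * ennreal (1 / (l / 2) ^ CARD('d) * (3 * l) ^ CARD('d))"
    unfolding q_def mult.assoc using l by (subst ennreal_mult) auto
  also have "1 / (l / 2) ^ CARD('d) * (3 * l) ^ CARD('d) = (3 * l / (l / 2)) ^ CARD('d)"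
    unfolding power_divide by simp
  also have "3 * l / (l / 2) = 6"
    using l by simp
  finally show ?thesis by (simp add: mult.commute)
qed

lemma rate_eq:
  assumes "0 < l"
  shows "rate \<alpha> l k = ennreal ((2 powr \<alpha>) ^ k) * rate \<alpha> l 0"
proof (induction k)
  case (Suc k)
  then show ?case
    by (simp add: rate_Suc[OF assms] ennreal_mult mult.assoc)
qed simp

text \<open>If all cubes of half the size in the triple are light, then so is the whole triple, and by
  the previous estimate the points of the triple lying in more than \<open>n\<close> nested cubes that meet
  \<open>E\<close> have little influence; the other points satisfy a trivial bound.\<close>

lemma heavy_half_cell:
  fixes D :: "(real ^ 'd::finite) set set"
  assumes D: "dyadic_lattice D" and E: "E \<noteq> {}" "emeasure lebesgue (closure E) = 0"
    and "0 < \<alpha>" "0 < \<xi>" "0 < G"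
    and X: "\<forall>R\<in>D. weight_measure \<alpha> E R < \<infinity> \<and>
      (\<Sum>\<^sub>\<infinity>Q\<in>meeting_cubes E R. weight_measure \<alpha> E Q) \<le> ennreal \<xi> * weight_measure \<alpha> E R"
  obtains K where "0 < K"
    "\<And>a l. 0 < l \<Longrightarrow> half_open_cube a l \<in> D \<Longrightarrow>
      ennreal K * scaled_volume \<alpha> (half_open_cube a l) < weight_measure \<alpha> E (half_open_cube a l) \<Longrightarrow>
      \<exists>m. cell a l 1 m \<subseteq> triple a l \<and>
        ennreal G * weight_measure \<alpha> E (half_open_cube a l) \<le> weight_measure \<alpha> E (cell a l 1 m)"
proof -
  define c where "c = 2 powr \<alpha> * real (card {v :: int ^ 'd. \<forall>i. \<bar>v $ i\<bar> \<le> 1})"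
  have c: "0 \<le> c" by (simp add: c_def)
  \<comment> \<open>One \<xi> for each use of the hypothesis, \<open>6 ^ CARD('d) * G\<close> from
    the triple being light. With the choice of \<open>n\<close> below,
    \<open>c * A / (n + 1)\<close> is less than 1/2, so the deep levels contribute at most half of
    the weight of the cube.\<close>
  define A where "A = \<xi> * \<xi> * 6 ^ CARD('d) * G"
  have A: "0 < A" using assms by (simp add: A_def)
  obtain n where n: "2 * c * A < real n"
    using reals_Archimedean2 by blast
  \<comment> \<open>\<open>(2 powr \<alpha>) ^ n\<close> is the factor in the trivial bound down to
    level \<open>n\<close>; the 2 comes from absorbing half of the weight into the left-hand
    side.\<close>
  define K where "K = 2 * (2 powr \<alpha>) ^ n"
  have "\<exists>m. cell a l 1 m \<subseteq> triple a l \<and>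
        ennreal G * weight_measure \<alpha> E (half_open_cube a l) \<le> weight_measure \<alpha> E (cell a l 1 m)"
    if l: "0 < l" and R: "half_open_cube a l \<in> D" and big:
      "ennreal K * scaled_volume \<alpha> (half_open_cube a l) < weight_measure \<alpha> E (half_open_cube a l)" for a l
  proof (rule ccontr)
    assume no: "\<not> ?thesis"
    define W where "W = weight_measure \<alpha> E (half_open_cube a l)"
    define J where "J = (\<integral>\<^sup>+y\<in>triple a l. (\<Sum>k. if hits E a l (n + k) y then rate \<alpha> l (n + k) else 0) \<partial>lebesgue)"
    \<comment> \<open>The absorption is a subtraction, legitimate for finite weights only; hence the
      passage from \<open>ennreal\<close> to real numbers.\<close>
    have "W < \<infinity>" using X R by (simp add: W_def)
    then obtain w where w: "0 \<le> w" "W = ennreal w"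
      by (cases W) auto
    have "(\<integral>\<^sup>+y\<in>cell a l 1 m. dist_weight \<alpha> E y \<partial>lebesgue) \<le> ennreal G * W"
      if "cell a l 1 m \<subseteq> triple a l" for m
      using no that unfolding W_def weight_measure_def by (meson linear)
    then have tri: "(\<integral>\<^sup>+y\<in>triple a l. dist_weight \<alpha> E y \<partial>lebesgue) \<le> ennreal (6 ^ CARD('d)) * (ennreal G * W)"
      by (rule nn_integral_triple_le_half_cells[OF l dist_weight_measurable[OF E(1)]])
    have "\<forall>R\<in>D. (\<Sum>\<^sub>\<infinity>Q\<in>meeting_cubes E R. weight_measure \<alpha> E Q) \<le> ennreal \<xi> * weight_measure \<alpha> E R"
      using X by blast
    from sum_hits_rate_le_weight[OF D E(1) \<open>0 < \<alpha>\<close> this l R, of n]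
    have "of_nat (Suc n) * J \<le> ennreal \<xi> * (ennreal \<xi> * (\<integral>\<^sup>+y\<in>triple a l. dist_weight \<alpha> E y \<partial>lebesgue))"
      unfolding J_def .
    also have "\<dots> \<le> ennreal \<xi> * (ennreal \<xi> * (ennreal (6 ^ CARD('d)) * (ennreal G * W)))"
      by (intro mult_left_mono tri) simp_all
    also have "\<dots> = ennreal (A * w)"
      using \<open>0 < \<xi>\<close> \<open>0 < G\<close> w by (simp add: A_def mult.assoc flip: ennreal_mult)
    finally have J1: "of_nat (Suc n) * J \<le> ennreal (A * w)" .
    have "J < \<infinity>"
    proof (rule ccontr)
      assume "\<not> J < \<infinity>"
      then have "J = top" by (simp add: not_less top_unique)
      then have "of_nat (Suc n) * J = top" by (simp add: ennreal_mult_top)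
      with J1 show False by (simp add: top_unique)
    qed
    then obtain j where j: "0 \<le> j" "J = ennreal j"
      by (cases J) auto
    have "real (Suc n) * j \<le> A * w"
      using J1 j A w unfolding j(2) ennreal_of_nat_eq_real_of_nat
      by (simp add: ennreal_le_iff flip: ennreal_mult del: of_nat_Suc)
    define r where "r = l powr - \<alpha> * l ^ CARD('d)"
    have r: "0 \<le> r" using l by (simp add: r_def)
    have sv: "scaled_volume \<alpha> (half_open_cube a l) = ennreal r"
      unfolding scaled_volume_half_open_cube[OF l] rate_def r_def using l
      by (simp add: emeasure_half_open_cube ennreal_mult del: emeasure_completion)
    have "W \<le> rate \<alpha> l n * emeasure lebesgue (half_open_cube a l) + ennreal c * J"
      unfolding W_def c_def J_def by (rule weight_measure_le_sum_hits[OF l \<open>0 < \<alpha>\<close> E])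
    also have "rate \<alpha> l n * emeasure lebesgue (half_open_cube a l) =
        ennreal ((2 powr \<alpha>) ^ n) * scaled_volume \<alpha> (half_open_cube a l)"
      unfolding scaled_volume_half_open_cube[OF l] rate_eq[OF l, of \<alpha> n] mult.assoc ..
    also have "ennreal ((2 powr \<alpha>) ^ n) * scaled_volume \<alpha> (half_open_cube a l) + ennreal c * J =
        ennreal ((2 powr \<alpha>) ^ n * r + c * j)"
      unfolding sv j(2) using r c j by (simp add: ennreal_mult)
    finally have "ennreal w \<le> ennreal ((2 powr \<alpha>) ^ n * r + c * j)"
      unfolding w(2) .
    then have le: "w \<le> (2 powr \<alpha>) ^ n * r + c * j"
      by (rule ennreal_le_iff[THEN iffD1, rotated]) (use r c j in simp)
    have "2 * c * A * w \<le> real (Suc n) * w"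
      using n w(1) by (intro mult_right_mono) auto
    moreover have "c * (real (Suc n) * j) \<le> c * (A * w)"
      using \<open>real (Suc n) * j \<le> A * w\<close> c by (rule mult_left_mono)
    ultimately have "real (Suc n) * (2 * c * j) \<le> real (Suc n) * w"
      by (simp add: algebra_simps)
    then have "2 * c * j \<le> w" by simp
    with le have "w \<le> K * r" by (simp add: K_def)
    then have "W \<le> ennreal K * scaled_volume \<alpha> (half_open_cube a l)"
      unfolding sv w(2) using r by (simp add: ennreal_le_iff K_def flip: ennreal_mult)
    with big show False by (simp add: W_def)
  qed
  moreover have "0 < K" by (simp add: K_def)
  ultimately show thesis by (rule that[rotated])
qed

lemma weight_bound_if_meeting_weight_bound:
  fixes D :: "(real ^ 'd::finite) set set"
  assumes D: "dyadic_lattice D" and E: "E \<noteq> {}" "emeasure lebesgue (closure E) = 0"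
    and "0 < \<alpha>" "0 < \<xi>"
    and X: "\<forall>R\<in>D. weight_measure \<alpha> E R < \<infinity> \<and>
      (\<Sum>\<^sub>\<infinity>Q\<in>meeting_cubes E R. weight_measure \<alpha> E Q) \<le> ennreal \<xi> * weight_measure \<alpha> E R"
  shows "\<exists>C>0. \<forall>R\<in>D. weight_measure \<alpha> E R \<le> ennreal C * scaled_volume \<alpha> R"
proof -
  \<comment> \<open>Being at least \<open>2 powr \<alpha>\<close>, \<open>G\<close> makes the excess
    over \<open>K\<close> times the scaled volume survive the passage to a cube of half the side;
    being greater than 1, it makes the weights unbounded.\<close>
  define G where "G = 2 + 2 powr \<alpha>"
  have "0 < G" by (simp add: G_def add_pos_pos)
  obtain K where "0 < K" and K: "\<And>a l. 0 < l \<Longrightarrow> half_open_cube a l \<in> D \<Longrightarrow>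
      ennreal K * scaled_volume \<alpha> (half_open_cube a l) < weight_measure \<alpha> E (half_open_cube a l) \<Longrightarrow>
      \<exists>m. cell a l 1 m \<subseteq> triple a l \<and>
        ennreal G * weight_measure \<alpha> E (half_open_cube a l) \<le> weight_measure \<alpha> E (cell a l 1 m)"
    using heavy_half_cell[OF D E \<open>0 < \<alpha>\<close> \<open>0 < \<xi>\<close> \<open>0 < G\<close> X] by blast
  \<comment> \<open>Iterated halving moves the centre by a geometrically decreasing amount, so all the cubes stay in
    a bounded region, whose weight is finite.\<close>
  have chain: "\<exists>Q\<in>D. Q \<subseteq> {y. \<forall>i. \<bar>y $ i - a $ i\<bar> \<le> 4 * l} \<and>
      ennreal (G ^ s) * weight_measure \<alpha> E (half_open_cube a l) \<le> weight_measure \<alpha> E Q"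
    if "0 < l" "half_open_cube a l \<in> D"
      "ennreal K * scaled_volume \<alpha> (half_open_cube a l) < weight_measure \<alpha> E (half_open_cube a l)" for s a l
    using that
  proof (induction s arbitrary: a l)
    case 0
    have "half_open_cube a l \<subseteq> {y. \<forall>i. \<bar>y $ i - a $ i\<bar> \<le> 4 * l}"
    proof safe
      fix y i assume "y \<in> half_open_cube a l"
      then have "a $ i \<le> y $ i" "y $ i < a $ i + l"
        by (simp_all add: half_open_cube_def)
      with \<open>0 < l\<close> show "\<bar>y $ i - a $ i\<bar> \<le> 4 * l"
        by linarith
    qed
    then show ?case
      using 0(2) by (intro bexI[of _ "half_open_cube a l"]) simp_all
  next
    case (Suc s)
    let ?R = "half_open_cube a l"
    obtain m where m: "cell a l 1 m \<subseteq> triple a l"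
      "ennreal G * weight_measure \<alpha> E ?R \<le> weight_measure \<alpha> E (cell a l 1 m)"
      using K[OF Suc.prems] by blast
    define b where "b = corner a l 1 m"
    have b: "cell a l 1 m = half_open_cube b (l / 2)"
      using cell_eq_half_open_cube[OF Suc.prems(1), of a 1 m] by (simp add: b_def)
    have bD: "half_open_cube b (l / 2) \<in> D"
      using lattice_cell[OF D Suc.prems(1,2), of 1 m] by (simp only: b)
    have sv: "scaled_volume \<alpha> (half_open_cube b (l / 2)) \<le> ennreal G * scaled_volume \<alpha> ?R"
    proof -
      have "rate \<alpha> (l / 2) 0 = rate \<alpha> l 1"
        by (simp add: rate_def)
      also have "\<dots> = ennreal (2 powr \<alpha>) * rate \<alpha> l 0"
        using rate_Suc[OF Suc.prems(1), of \<alpha> 0] by simp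
      also have "\<dots> \<le> ennreal G * rate \<alpha> l 0"
        by (intro mult_right_mono ennreal_leI) (simp_all add: G_def)
      finally have "rate \<alpha> (l / 2) 0 \<le> ennreal G * rate \<alpha> l 0" .
      moreover have "emeasure lebesgue (half_open_cube b (l / 2)) \<le> emeasure lebesgue ?R"
        using Suc.prems(1) by (simp add: emeasure_half_open_cube power_mono ennreal_leI del: emeasure_completion)
      ultimately show ?thesis
        using Suc.prems(1) by (simp only: scaled_volume_half_open_cube half_gt_zero mult.assoc[symmetric] mult_mono zero_le)
    qed
    have "ennreal K * scaled_volume \<alpha> (half_open_cube b (l / 2)) \<le> ennreal G * (ennreal K * scaled_volume \<alpha> ?R)"
      using mult_left_mono[OF sv, of "ennreal K"] by (simp add: mult.left_commute)
    also have "\<dots> < ennreal G * weight_measure \<alpha> E ?R"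
      using Suc.prems(3) \<open>0 < G\<close> by (intro ennreal_mult_strict_left_mono) simp_all
    also have "\<dots> \<le> weight_measure \<alpha> E (half_open_cube b (l / 2))"
      using m(2) unfolding b .
    finally obtain Q where Q: "Q \<in> D" "Q \<subseteq> {y. \<forall>i. \<bar>y $ i - b $ i\<bar> \<le> 4 * (l / 2)}"
      "ennreal (G ^ s) * weight_measure \<alpha> E (half_open_cube b (l / 2)) \<le> weight_measure \<alpha> E Q"
      using Suc.IH[of "l / 2" b] bD Suc.prems(1) by auto
    have "b \<in> cell a l 1 m"
      unfolding b using Suc.prems(1) by (simp add: half_open_cube_def)
    then have "b \<in> half_open_cube (\<chi> i. a $ i - l) (3 * l)"
      using m(1) triple_eq_half_open_cube[OF Suc.prems(1)] by blast
    then have ba: "\<bar>b $ i - a $ i\<bar> \<le> 2 * l" for i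
      using Suc.prems(1) unfolding half_open_cube_def by (simp add: abs_le_iff) (smt (verit))
    \<comment> \<open>The radius reproduces itself: the corner moves by at most
      \<open>2 * l\<close>, and the induction hypothesis for side \<open>l / 2\<close> adds
      \<open>4 * (l / 2)\<close>.\<close>
    have "Q \<subseteq> {y. \<forall>i. \<bar>y $ i - a $ i\<bar> \<le> 4 * l}"
    proof safe
      fix y i assume "y \<in> Q"
      then have "\<bar>y $ i - b $ i\<bar> \<le> 2 * l" using Q(2) by auto
      with ba[of i] show "\<bar>y $ i - a $ i\<bar> \<le> 4 * l" by linarith
    qed
    moreover have "ennreal (G ^ Suc s) * weight_measure \<alpha> E ?R \<le> weight_measure \<alpha> E Q"
    proof -
      have "ennreal (G ^ Suc s) * weight_measure \<alpha> E ?R = ennreal (G ^ s) * (ennreal G * weight_measure \<alpha> E ?R)"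
        using \<open>0 < G\<close> by (simp add: ennreal_mult mult_ac)
      also have "\<dots> \<le> ennreal (G ^ s) * weight_measure \<alpha> E (half_open_cube b (l / 2))"
        using m(2) unfolding b by (rule mult_left_mono) simp
      finally show ?thesis using Q(3) by (rule order_trans)
    qed
    ultimately show ?case using Q(1) by blast
  qed
  have "weight_measure \<alpha> E R \<le> ennreal K * scaled_volume \<alpha> R" if "R \<in> D" for R
  proof (rule ccontr)
    assume "\<not> ?thesis"
    then have big: "ennreal K * scaled_volume \<alpha> R < weight_measure \<alpha> E R" by simp
    obtain a l where l: "0 < l" and R: "R = half_open_cube a l"
      by (rule lattice_cubeE[OF D \<open>R \<in> D\<close>])
    define B where "B = cbox (\<chi> i. a $ i - 4 * l) (\<chi> i. a $ i + 4 * l)"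
    have B: "{y. \<forall>i. \<bar>y $ i - a $ i\<bar> \<le> 4 * l} \<subseteq> B"
      by (auto simp: B_def mem_box_cart abs_le_iff algebra_simps)
    have "compact B" by (simp add: B_def)
    then obtain P where P: "P \<in> D" "B \<subseteq> P"
      using D unfolding dyadic_lattice_def by blast
    have le: "ennreal (G ^ s) * weight_measure \<alpha> E R \<le> weight_measure \<alpha> E P" for s
    proof -
      obtain Q where "Q \<subseteq> B" "ennreal (G ^ s) * weight_measure \<alpha> E R \<le> weight_measure \<alpha> E Q"
        using chain[OF l \<open>R \<in> D\<close>[unfolded R] big[unfolded R], of s] B unfolding R by blast
      moreover have "weight_measure \<alpha> E Q \<le> weight_measure \<alpha> E P"
        unfolding weight_measure_def using \<open>Q \<subseteq> B\<close> P(2)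
        by (intro nn_integral_mono mult_left_mono) (auto simp: indicator_def)
      ultimately show ?thesis by (meson order_trans)
    qed
    obtain w where w: "0 \<le> w" "weight_measure \<alpha> E R = ennreal w"
      using X \<open>R \<in> D\<close> by (cases "weight_measure \<alpha> E R") auto
    obtain p where p: "0 \<le> p" "weight_measure \<alpha> E P = ennreal p"
      using X P(1) by (cases "weight_measure \<alpha> E P") auto
    have "0 < weight_measure \<alpha> E R" using big by (rule le_less_trans[rotated]) simp
    then have "0 < w" by (simp add: w(2))
    have "1 < G" by (simp add: G_def add_pos_pos)
    then obtain s where s: "p / w < G ^ s" using real_arch_pow by blast
    have "G ^ s * w \<le> p"
      using le[of s] w p \<open>0 < G\<close> by (simp add: ennreal_le_iff flip: ennreal_mult)
    with s \<open>0 < w\<close> show False by (simp add: field_simps)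
  qed
  with \<open>0 < K\<close> show ?thesis by blast
qed

text \<open>Weights are replaced by scaled volumes cube by cube, these are summed, and the result is
  turned back into the weight of \<open>R\<close>. The last exchange holds because every point of a
  cube meeting \<open>E\<close> has distance at most the side from \<open>E\<close>.\<close>

lemma meeting_weight_bound_if_weight_bound:
  fixes D :: "(real ^ 'd::finite) set set"
  assumes D: "dyadic_lattice D" and E: "E \<noteq> {}" and "0 < \<alpha>" "0 < C" "0 < \<zeta>"
    and M: "\<forall>R\<in>D. weight_measure \<alpha> E R \<le> ennreal C * scaled_volume \<alpha> R"
    and Z: "\<forall>R\<in>D. (\<Sum>\<^sub>\<infinity>Q\<in>meeting_cubes E R. scaled_volume \<alpha> Q) \<le> ennreal \<zeta> * scaled_volume \<alpha> R"
  shows "\<exists>\<xi>>0. \<forall>R\<in>D. weight_measure \<alpha> E R < \<infinity> \<and>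
      (\<Sum>\<^sub>\<infinity>Q\<in>meeting_cubes E R. weight_measure \<alpha> E Q) \<le> ennreal \<xi> * weight_measure \<alpha> E R"
proof -
  have "weight_measure \<alpha> E R < \<infinity> \<and>
      (\<Sum>\<^sub>\<infinity>Q\<in>meeting_cubes E R. weight_measure \<alpha> E Q) \<le> ennreal (C * \<zeta>) * weight_measure \<alpha> E R"
    if "R \<in> D" for R
  proof
    obtain a l where l: "0 < l" and R: "R = half_open_cube a l"
      by (rule lattice_cubeE[OF D \<open>R \<in> D\<close>])
    have "ennreal C * scaled_volume \<alpha> R < \<infinity>"
      by (simp add: scaled_volume_def ennreal_mult_less_top)
    then show "weight_measure \<alpha> E R < \<infinity>"
      using M that by (meson le_less_trans)
    show "(\<Sum>\<^sub>\<infinity>Q\<in>meeting_cubes E R. weight_measure \<alpha> E Q) \<le> ennreal (C * \<zeta>) * weight_measure \<alpha> E R"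
    proof (cases "R \<inter> E = {}")
      case True
      then show ?thesis
        by (simp add: meeting_cubes_eq_empty[OF D that])
    next
      case False
      have sub: "meeting_cubes E R \<subseteq> D"
        using D that by (auto simp: dyadic_lattice_def meeting_cubes_def)
      have "countable (meeting_cubes E R)"
        unfolding R by (rule countable_subset[OF _ countable_dyadic_cubes[OF l]]) (auto simp: meeting_cubes_def)
      note inf = infsum_ennreal_eq_nn_integral[OF this]
      have "(\<Sum>\<^sub>\<infinity>Q\<in>meeting_cubes E R. weight_measure \<alpha> E Q) \<le>
          (\<integral>\<^sup>+Q. ennreal C * scaled_volume \<alpha> Q \<partial>count_space (meeting_cubes E R))"
        unfolding inf using M sub by (intro nn_integral_mono) auto
      also have "\<dots> = ennreal C * (\<Sum>\<^sub>\<infinity>Q\<in>meeting_cubes E R. scaled_volume \<alpha> Q)"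
        unfolding inf by (rule nn_integral_cmult) simp
      also have "\<dots> \<le> ennreal C * (ennreal \<zeta> * scaled_volume \<alpha> R)"
        using Z that by (intro mult_left_mono) auto
      also have "\<dots> \<le> ennreal C * (ennreal \<zeta> * weight_measure \<alpha> E R)"
        using scaled_volume_le_weight_measure[OF l \<open>0 < \<alpha>\<close>, of a E] False unfolding R
        by (intro mult_left_mono) auto
      finally show ?thesis
        using \<open>0 < C\<close> \<open>0 < \<zeta>\<close> by (simp add: ennreal_mult mult.assoc)
    qed
  qed
  then show ?thesis
    using \<open>0 < C\<close> \<open>0 < \<zeta>\<close> by (intro exI[of _ "C * \<zeta>"]) simp
qed

lemma SUP_ennreal_cong_positive:
  assumes "\<And>x. 0 < x \<Longrightarrow> P x \<longleftrightarrow> Q x"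
  shows "(SUP x\<in>{x::real. 0 \<le> x \<and> P x}. ennreal x) = (SUP x\<in>{x. 0 \<le> x \<and> Q x}. ennreal x)"
proof -
  have le: "(SUP x\<in>{x::real. 0 \<le> x \<and> P x}. ennreal x) \<le> (SUP x\<in>{x. 0 \<le> x \<and> Q x}. ennreal x)"
    if PQ: "\<And>x. 0 < x \<Longrightarrow> P x \<Longrightarrow> Q x" for P Q
  proof (rule SUP_least)
    fix x :: real assume x: "x \<in> {x. 0 \<le> x \<and> P x}"
    show "ennreal x \<le> (SUP x\<in>{x. 0 \<le> x \<and> Q x}. ennreal x)"
    proof (cases "x = 0")
      case False
      with x PQ show ?thesis by (intro SUP_upper) auto
    qed simp
  qed
  show ?thesis
    using assms by (intro antisym le) auto
qed

text \<open>The finiteness clause in the last condition gives the inequality its content: if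
  \<open>E\<close> is a single point and \<alpha> is at least the dimension, every cube containing
  the point has infinite weight, and without the clause the bound would hold in the form \<infinity>
  \<le> \<infinity>.\<close>

theorem corollary2:
  fixes D :: "(real ^ 'd::finite) set set" and E :: "(real ^ 'd) set"
  assumes "dyadic_lattice D"
    and "E \<noteq> {}"
    and "emeasure lebesgue (closure E) = 0"
  shows "codim_A D E =
           (SUP \<alpha> \<in> {\<alpha>::real. 0 \<le> \<alpha> \<and> (\<exists>\<zeta>::real. 0 < \<zeta> \<and>
                (\<forall>R\<in>D. (\<Sum>\<^sub>\<infinity>Q \<in> meeting_cubes E R. scaled_volume \<alpha> Q)
                          \<le> ennreal \<zeta> * scaled_volume \<alpha> R))}. ennreal \<alpha>)
       \<and> codim_A D E =
           (SUP \<alpha> \<in> {\<alpha>::real. 0 \<le> \<alpha> \<and> (\<exists>\<xi>::real. 0 < \<xi> \<and>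
                (\<forall>R\<in>D. weight_measure \<alpha> E R < \<infinity> \<and>
                        (\<Sum>\<^sub>\<infinity>Q \<in> meeting_cubes E R. weight_measure \<alpha> E Q)
                          \<le> ennreal \<xi> * weight_measure \<alpha> E R))}. ennreal \<alpha>)"
  unfolding codim_A_def
proof (intro conjI SUP_ennreal_cong_positive)
  fix \<alpha> :: real assume \<alpha>: "0 < \<alpha>"
  note AZ = meeting_volume_bound_if_free_volume_bound[OF assms \<alpha>]
    and ZA = free_volume_bound_if_meeting_volume_bound[OF assms(1), where E = E and \<alpha> = \<alpha>]
    and ZM = weight_bound_if_meeting_volume_bound[OF assms \<alpha>]
    and MZ = meeting_volume_bound_if_weight_bound[OF assms \<alpha>]
    and XM = weight_bound_if_meeting_weight_bound[OF assms \<alpha>]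
    and MX = meeting_weight_bound_if_weight_bound[OF assms(1,2) \<alpha>]
  let ?A = "\<exists>C>0. \<forall>R\<in>(\<Union>S\<in>D. meeting_cubes E S).
    (\<Sum>\<^sub>\<infinity>Q\<in>maximal_free_cubes D E R. scaled_volume \<alpha> Q) \<le> ennreal C * scaled_volume \<alpha> R"
  let ?Z = "\<exists>\<zeta>>0. \<forall>R\<in>D. (\<Sum>\<^sub>\<infinity>Q\<in>meeting_cubes E R. scaled_volume \<alpha> Q) \<le> ennreal \<zeta> * scaled_volume \<alpha> R"
  let ?X = "\<exists>\<xi>>0. \<forall>R\<in>D. weight_measure \<alpha> E R < \<infinity> \<and>
    (\<Sum>\<^sub>\<infinity>Q\<in>meeting_cubes E R. weight_measure \<alpha> E Q) \<le> ennreal \<xi> * weight_measure \<alpha> E R"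
  let ?M = "\<exists>C>0. \<forall>R\<in>D. weight_measure \<alpha> E R \<le> ennreal C * scaled_volume \<alpha> R"
  show AZ_iff: "?A \<longleftrightarrow> ?Z"
    by (intro iffI; elim exE conjE; erule (1) AZ ZA)
  have "?Z \<longleftrightarrow> ?M"
    by (intro iffI; elim exE conjE; erule (1) ZM MZ)
  moreover have "?X \<longrightarrow> ?M"
    by (intro impI; elim exE conjE; erule (1) XM)
  moreover have "?M \<longrightarrow> ?Z \<longrightarrow> ?X"
    by (intro impI; elim exE conjE; erule (3) MX)
  ultimately show "?A \<longleftrightarrow> ?X"
    unfolding AZ_iff by blast
qed

end
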